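(* Let $q=(q_1,\ldots,q_n)$ be a normally admissible presentation of the fixed-point ideal $I=(g_1,\ldots,g_n)\subset R=\mathbb C\{z_1,\ldots,z_k,w_1,\ldots,w_m\}$, $n=k+m$, of an isolated boundary fixed point of a strict logarithmic self-map, and let $h\in R$. For $t\ne0$ (sufficiently small), $$\mathscr R_{q,\,h(tz,w)\Delta_q(tz,w)}(t)=t^{e(q)}\operatorname{Res}_0\left[\frac{h\,\mathrm dz\wedge \mathrm dw}{g_1,\ldots,g_n}\right].$$ Consequently, $$\operatorname{Res}_0\left[\frac{h\,\mathrm dz\wedge \mathrm dw}{g_1,\ldots,g_n}\right]=\frac1{e(q)!}\left.\frac{\mathrm d^{e(q)}}{\mathrm dt^{e(q)}}\mathscr R_{q,\,h(tz,w)\Delta_q(tz,w)}(t)\right|_{t=0}.$$ If $e(q)=0$, this becomes $$\operatorname{Res}_0\left[\frac{h\,\mathrm dz\wedge \mathrm dw}{g_1,\ldots,g_n}\right]=\operatorname{Res}_0\left[\frac{h(0,w)\Delta_q(0,w)\,\mathrm dz\wedge \mathrm dw}{\operatorname{in}_D(q_1),\ldots,\operatorname{in}_D(q_n)}\right].$$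
   Context: Local setting: near a boundary fixed point $p$ of a strict logarithmic self-map $f$ (i.e. $f^{-1}\mathcal I_{D_i}\cdot\mathcal O_X=\mathcal I_{D_i}$ for each component $D_i$ of a simple normal crossings divisor $D$) take adapted coordinates $(z_1,\ldots,z_k,w_1,\ldots,w_m)$ centred at $p$, $D=\{z_1\cdots z_k=0\}$, $f^*z_i=z_ia_i$ with $a_i$ units, $f^*w_\alpha=F_\alpha$. The coordinate fixed-point equations $g_1,\ldots,g_n$ are $z_i(1-a_i)$ and $w_\alpha-F_\alpha$; $I=(g_1,\ldots,g_n)$ is $\mathfrak m$-primary since the fixed point is isolated. Write $\mathrm dz=\mathrm dz_1\wedge\cdots\wedge \mathrm dz_k$, $\mathrm dw=\mathrm dw_1\wedge\cdots\wedge \mathrm dw_m$. For $0\ne h=\sum_{\alpha\in\mathbb N^k}h_\alpha(w)z^\alpha\in R$, $\nu_D(h)=\min\{|\alpha|:h_\alpha\ne0\}$ and $\operatorname{in}_D(h)=\sum_{|\alpha|=\nu_D(h)}h_\alpha(w)z^\alpha$. A regular sequence $q_1,\ldots,q_n$ generating $I$ is a normally admissible presentation if $R/(\operatorname{in}_D(q_1),\ldots,\operatorname{in}_D(q_n))$ has finite length and $\sum_j\nu_D(q_j)\ge k$. One writes $(q_1,\ldots,q_n)^t=A(g_1,\ldots,g_n)^t$ with $A\in\operatorname{GL}_n(R)$ and sets $\Delta_q=\det A\in R^\times$. Put $d_j=\nu_D(q_j)$, $e(q)=\sum_jd_j-k$, $Q_j(t,z,w)=t^{-d_j}q_j(tz,w)$,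 and for a holomorphic germ $H(t,z,w)$ $$\mathscr R_{q,H}(t)=\operatorname{Res}_0\left[\frac{H(t,z,w)\,\mathrm dz\wedge \mathrm dw}{Q_1(t),\ldots,Q_n(t)}\right],$$ where $Q_j(t)=Q_j(t,\cdot,\cdot)$ (so $Q_j(0)=\operatorname{in}_D(q_j)$). This is a holomorphic function of $t$ near $0$. $\operatorname{Res}_0$ is the Grothendieck residue. *)

theory Defs
  imports "HOL-Analysis.Analysis"
begin

section \<open>Convergent power series in the variables indexed by a finite type\<close>

text \<open>
  A multi-index is a vector of type \<^typ>\<open>nat^'n\<close>.  For a set \<open>K\<close> of variables, \<open>mdeg K \<alpha>\<close>
  is the degree of the monomial \<open>x\<^sup>\<alpha>\<close> in the variables of \<open>K\<close> alone.
\<close>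

definition mdeg :: "'n set \<Rightarrow> nat^'n \<Rightarrow> nat" where
  "mdeg K \<alpha> = (\<Sum>i\<in>K. \<alpha> $ i)"

definition converges_near_0 :: "(nat^'n \<Rightarrow> complex) \<Rightarrow> bool" where
  "converges_near_0 a \<longleftrightarrow>
     (\<exists>r>0. (\<lambda>\<alpha>. norm (a \<alpha>) * r ^ mdeg UNIV \<alpha>) summable_on UNIV)"

lemma mdeg_add: "mdeg K (\<alpha> + \<beta>) = mdeg K \<alpha> + mdeg K \<beta>"
  by (simp add: mdeg_def sum.distrib)

lemma mdeg_le_UNIV: "mdeg K (\<alpha> :: nat^'n) \<le> mdeg UNIV \<alpha>"
  unfolding mdeg_def by (rule sum_mono2) auto

lemma weighted_summable_mono:
  fixes a b :: "nat^'n \<Rightarrow> complex"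
  assumes "(\<lambda>\<alpha>. norm (a \<alpha>) * r ^ mdeg UNIV \<alpha>) summable_on UNIV"
    and "0 \<le> s"
    and "\<And>\<alpha>. norm (b \<alpha>) * s ^ mdeg UNIV \<alpha> \<le> C * (norm (a \<alpha>) * r ^ mdeg UNIV \<alpha>)"
  shows "(\<lambda>\<alpha>. norm (b \<alpha>) * s ^ mdeg UNIV \<alpha>) summable_on UNIV"
  by (rule summable_on_comparison_test[OF summable_on_cmult_right[OF assms(1), of C]])
    (simp_all add: assms(2,3))

lemma converges_near_0_common_radius:
  assumes "converges_near_0 a" "converges_near_0 b"
  shows "\<exists>r>0. (\<lambda>\<alpha>. norm (a \<alpha>) * r ^ mdeg UNIV \<alpha>) summable_on UNIV \<and>
               (\<lambda>\<alpha>. norm (b \<alpha>) * r ^ mdeg UNIV \<alpha>) summable_on UNIV"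
proof -
  obtain r s where rs: "r > 0" "s > 0"
    "(\<lambda>\<alpha>. norm (a \<alpha>) * r ^ mdeg UNIV \<alpha>) summable_on UNIV"
    "(\<lambda>\<alpha>. norm (b \<alpha>) * s ^ mdeg UNIV \<alpha>) summable_on UNIV"
    using assms unfolding converges_near_0_def by blast
  have "(\<lambda>\<alpha>. norm (a \<alpha>) * min r s ^ mdeg UNIV \<alpha>) summable_on UNIV"
    by (rule weighted_summable_mono[OF rs(3), where C=1])
      (use rs in \<open>auto intro!: mult_left_mono power_mono\<close>)
  moreover have "(\<lambda>\<alpha>. norm (b \<alpha>) * min r s ^ mdeg UNIV \<alpha>) summable_on UNIV"
    by (rule weighted_summable_mono[OF rs(4), where C=1])
      (use rs in \<open>auto intro!: mult_left_mono power_mono\<close>)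
  ultimately show ?thesis using rs by (intro exI[of _ "min r s"]) auto
qed

lemma converges_near_0_add:
  assumes "converges_near_0 a" "converges_near_0 b"
  shows "converges_near_0 (\<lambda>\<alpha>. a \<alpha> + b \<alpha>)"
proof -
  obtain r where r: "r > 0" "(\<lambda>\<alpha>. norm (a \<alpha>) * r ^ mdeg UNIV \<alpha>) summable_on UNIV"
    "(\<lambda>\<alpha>. norm (b \<alpha>) * r ^ mdeg UNIV \<alpha>) summable_on UNIV"
    using converges_near_0_common_radius[OF assms] by blast
  have "(\<lambda>\<alpha>. norm (a \<alpha> + b \<alpha>) * r ^ mdeg UNIV \<alpha>) summable_on UNIV"
    by (rule summable_on_comparison_test[OF summable_on_add[OF r(2,3)]])
      (use r(1) in \<open>auto simp flip: distrib_right intro!: mult_right_mono norm_triangle_ineq\<close>)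
  then show ?thesis using r(1) unfolding converges_near_0_def by blast
qed

lemma converges_near_0_finite:
  assumes "finite {\<alpha>. a \<alpha> \<noteq> 0}"
  shows "converges_near_0 a"
proof -
  have "(\<lambda>\<alpha>. norm (a \<alpha>) * 1 ^ mdeg UNIV \<alpha>) summable_on UNIV"
    by (rule finite_nonzero_values_imp_summable_on) (use assms in auto)
  then show ?thesis unfolding converges_near_0_def by (intro exI[of _ 1]) auto
qed

lemma finite_multiindex_le: "finite {\<beta> :: nat^'n. \<forall>i. \<beta> $ i \<le> \<alpha> $ i}"
proof (rule finite_subset)
  show "{\<beta> :: nat^'n. \<forall>i. \<beta> $ i \<le> \<alpha> $ i} \<subseteq> vec_lambda ` (\<Pi>\<^sub>E i\<in>UNIV. {..\<alpha> $ i})"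
  proof
    fix \<beta> :: "nat^'n" assume "\<beta> \<in> {\<beta>. \<forall>i. \<beta> $ i \<le> \<alpha> $ i}"
    then have "vec_nth \<beta> \<in> (\<Pi>\<^sub>E i\<in>UNIV. {..\<alpha> $ i})" by auto
    then have "vec_lambda (vec_nth \<beta>) \<in> vec_lambda ` (\<Pi>\<^sub>E i\<in>UNIV. {..\<alpha> $ i})" by (rule imageI)
    then show "\<beta> \<in> vec_lambda ` (\<Pi>\<^sub>E i\<in>UNIV. {..\<alpha> $ i})" by simp
  qed
  show "finite (vec_lambda ` (\<Pi>\<^sub>E i\<in>UNIV. {..\<alpha> $ i}) :: (nat^'n) set)"
    by (intro finite_imageI finite_PiE) auto
qed

lemma finite_multiindex_splits: "finite {p :: (nat^'n) \<times> (nat^'n). fst p + snd p = \<alpha>}"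
  by (rule finite_subset[OF _ finite_cartesian_product[OF
        finite_multiindex_le[of \<alpha>] finite_multiindex_le[of \<alpha>]]]) auto

lemma converges_near_0_mult:
  fixes a b :: "nat^'n \<Rightarrow> complex"
  assumes "converges_near_0 a" "converges_near_0 b"
  shows "converges_near_0 (\<lambda>\<alpha>. \<Sum>p | fst p + snd p = \<alpha>. a (fst p) * b (snd p))"
proof -
  let ?S = "\<lambda>\<alpha> :: nat^'n. {p. fst p + snd p = \<alpha>}"
  obtain r where r: "r > 0" "(\<lambda>\<alpha>. norm (a \<alpha>) * r ^ mdeg UNIV \<alpha>) summable_on UNIV"
    "(\<lambda>\<alpha>. norm (b \<alpha>) * r ^ mdeg UNIV \<alpha>) summable_on UNIV"
    using converges_near_0_common_radius[OF assms] by blast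
  define A where "A = (\<lambda>\<alpha>. norm (a \<alpha>) * r ^ mdeg UNIV \<alpha>)"
  define B where "B = (\<lambda>\<alpha>. norm (b \<alpha>) * r ^ mdeg UNIV \<alpha>)"
  have nn: "A \<alpha> \<ge> 0" "B \<alpha> \<ge> 0" for \<alpha> using r(1) by (auto simp: A_def B_def)
  have sm: "A summable_on UNIV" "B summable_on UNIV" using r by (auto simp: A_def B_def)
  have bnd: "(\<Sum>\<alpha>\<in>F. norm (\<Sum>p\<in>?S \<alpha>. a (fst p) * b (snd p)) * r ^ mdeg UNIV \<alpha>)
      \<le> infsum A UNIV * infsum B UNIV" if F: "finite F" for F
  proof -
    have "(\<Sum>\<alpha>\<in>F. norm (\<Sum>p\<in>?S \<alpha>. a (fst p) * b (snd p)) * r ^ mdeg UNIV \<alpha>)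
        \<le> (\<Sum>\<alpha>\<in>F. \<Sum>p\<in>?S \<alpha>. A (fst p) * B (snd p))"
    proof (rule sum_mono)
      fix \<alpha> assume "\<alpha> \<in> F"
      have "norm (\<Sum>p\<in>?S \<alpha>. a (fst p) * b (snd p)) * r ^ mdeg UNIV \<alpha>
          \<le> (\<Sum>p\<in>?S \<alpha>. norm (a (fst p) * b (snd p))) * r ^ mdeg UNIV \<alpha>"
        using r(1) by (intro mult_right_mono norm_sum) auto
      also have "\<dots> = (\<Sum>p\<in>?S \<alpha>. A (fst p) * B (snd p))"
        by (auto simp: sum_distrib_right A_def B_def norm_mult mdeg_add power_add
            intro!: sum.cong)
      finally show "norm (\<Sum>p\<in>?S \<alpha>. a (fst p) * b (snd p)) * r ^ mdeg UNIV \<alpha>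
          \<le> (\<Sum>p\<in>?S \<alpha>. A (fst p) * B (snd p))" .
    qed
    also have "\<dots> = (\<Sum>p\<in>(\<Union>\<alpha>\<in>F. ?S \<alpha>). A (fst p) * B (snd p))"
      by (rule sum.UNION_disjoint[symmetric])
        (use F finite_multiindex_splits in auto)
    also have "\<dots> \<le> (\<Sum>p\<in>fst ` (\<Union>\<alpha>\<in>F. ?S \<alpha>) \<times> snd ` (\<Union>\<alpha>\<in>F. ?S \<alpha>). A (fst p) * B (snd p))"
    proof (rule sum_mono2)
      show "(\<Union>\<alpha>\<in>F. ?S \<alpha>) \<subseteq> fst ` (\<Union>\<alpha>\<in>F. ?S \<alpha>) \<times> snd ` (\<Union>\<alpha>\<in>F. ?S \<alpha>)"
        unfolding subset_eq mem_Times_iff by blast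
    qed (use F finite_multiindex_splits nn in \<open>auto intro!: finite_cartesian_product finite_imageI\<close>)
    also have "\<dots> = sum A (fst ` (\<Union>\<alpha>\<in>F. ?S \<alpha>)) * sum B (snd ` (\<Union>\<alpha>\<in>F. ?S \<alpha>))"
      by (simp add: sum_product sum.cartesian_product case_prod_unfold)
    also have "\<dots> \<le> infsum A UNIV * infsum B UNIV"
      using F finite_multiindex_splits nn sm
      by (intro mult_mono finite_sum_le_infsum sum_nonneg infsum_nonneg)
        (auto intro!: finite_imageI)
    finally show ?thesis .
  qed
  have "(\<lambda>\<alpha>. norm (\<Sum>p\<in>?S \<alpha>. a (fst p) * b (snd p)) * r ^ mdeg UNIV \<alpha>) summable_on UNIV"
    by (rule nonneg_bdd_above_summable_on)
      (use r(1) in \<open>auto intro!: bdd_aboveI2[where M="infsum A UNIV * infsum B UNIV"] bnd\<close>)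
  then show ?thesis using r(1) unfolding converges_near_0_def by blast
qed

text \<open>The ring \<open>\<complex>{x\<^sub>1, \<dots>, x\<^sub>n}\<close>, with \<open>n = CARD('n)\<close>.\<close>

typedef (overloaded) 'n cps = "{a :: nat^'n \<Rightarrow> complex. converges_near_0 a}"
  morphisms coeff Abs_cps
  by (rule exI[of _ "\<lambda>_. 0"]) (simp add: converges_near_0_finite)

setup_lifting type_definition_cps

lemma cps_eqI: "(\<And>\<alpha>. coeff f \<alpha> = coeff g \<alpha>) \<Longrightarrow> f = g"
  by (metis coeff_inject ext)

instantiation cps :: (finite) comm_ring_1
begin

lift_definition zero_cps :: "'a cps" is "\<lambda>_. 0"
  by (simp add: converges_near_0_finite)

lift_definition one_cps :: "'a cps" is "\<lambda>\<alpha>. if \<alpha> = 0 then 1 else 0"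
  by (simp add: converges_near_0_finite)

lift_definition plus_cps :: "'a cps \<Rightarrow> 'a cps \<Rightarrow> 'a cps" is "\<lambda>a b \<alpha>. a \<alpha> + b \<alpha>"
  by (rule converges_near_0_add)

lift_definition uminus_cps :: "'a cps \<Rightarrow> 'a cps" is "\<lambda>a \<alpha>. - a \<alpha>"
  by (simp add: converges_near_0_def)

definition minus_cps :: "'a cps \<Rightarrow> 'a cps \<Rightarrow> 'a cps" where
  "minus_cps f g = f + - g"

lift_definition times_cps :: "'a cps \<Rightarrow> 'a cps \<Rightarrow> 'a cps" is
  "\<lambda>a b \<alpha>. \<Sum>p | fst p + snd p = \<alpha>. a (fst p) * b (snd p)"
  by (rule converges_near_0_mult)

instance
proof
  fix f g h :: "'a cps"
  show "f * g * h = f * (g * h)"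
  proof (rule cps_eqI)
    fix \<alpha>
    let ?S = "\<lambda>\<alpha> :: nat^'a. {p. fst p + snd p = \<alpha>}"
    have "coeff (f * g * h) \<alpha> = (\<Sum>(p, q) \<in> Sigma (?S \<alpha>) (\<lambda>p. ?S (fst p)).
        coeff f (fst q) * coeff g (snd q) * coeff h (snd p))"
      by (simp add: times_cps.rep_eq sum_distrib_right sum.Sigma finite_multiindex_splits)
    also have "\<dots> = (\<Sum>(p, q) \<in> Sigma (?S \<alpha>) (\<lambda>p. ?S (snd p)).
        coeff f (fst p) * (coeff g (fst q) * coeff h (snd q)))"
      by (rule sum.reindex_bij_witness[where
            i = "\<lambda>(p, q). ((fst p + fst q, snd q), (fst p, fst q))" and
            j = "\<lambda>(p, q). ((fst q, snd q + snd p), (snd q, snd p))"])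
        (auto simp: add.assoc mult.assoc)
    also have "\<dots> = coeff (f * (g * h)) \<alpha>"
      by (simp add: times_cps.rep_eq sum_distrib_left sum.Sigma finite_multiindex_splits)
    finally show "coeff (f * g * h) \<alpha> = coeff (f * (g * h)) \<alpha>" .
  qed
  show "f * g = g * f"
    by (rule cps_eqI, unfold times_cps.rep_eq,
        rule sum.reindex_bij_witness[where i = prod.swap and j = prod.swap])
      (auto simp: add.commute mult.commute)
  show "1 * f = f"
  proof (rule cps_eqI)
    fix \<alpha>
    have "coeff (1 * f) \<alpha> = (\<Sum>p | fst p + snd p = \<alpha>. if p = (0, \<alpha>) then coeff f \<alpha> else 0)"
      unfolding times_cps.rep_eq by (rule sum.cong) (auto simp: one_cps.rep_eq)
    also have "\<dots> = coeff f \<alpha>"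
      using finite_multiindex_splits[of \<alpha>] by simp
    finally show "coeff (1 * f) \<alpha> = coeff f \<alpha>" .
  qed
  show "(f + g) * h = f * h + g * h"
    by (rule cps_eqI) (simp add: times_cps.rep_eq plus_cps.rep_eq distrib_right sum.distrib)
  show "f + g + h = f + (g + h)" "f + g = g + f" "0 + f = f"
    by (rule cps_eqI; simp add: plus_cps.rep_eq zero_cps.rep_eq)+
  show "- f + f = 0"
    by (rule cps_eqI) (simp add: plus_cps.rep_eq uminus_cps.rep_eq zero_cps.rep_eq)
  show "f - g = f + - g" by (fact minus_cps_def)
  have "coeff (0 :: 'a cps) 0 \<noteq> coeff 1 0" by (simp add: zero_cps.rep_eq one_cps.rep_eq)
  then show "(0 :: 'a cps) \<noteq> 1" by metis
qed

end

lift_definition coord :: "'n::finite \<Rightarrow> 'n cps" is "\<lambda>i \<alpha>. if \<alpha> = axis i 1 then 1 else 0"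
  by (simp add: converges_near_0_finite)

text \<open>The value at a point; meaningful only where the series converges.\<close>

definition cps_eval :: "'n cps \<Rightarrow> complex^'n \<Rightarrow> complex" where
  "cps_eval f x = (\<Sum>\<^sub>\<infinity>\<alpha>. coeff f \<alpha> * (\<Prod>i\<in>UNIV. x $ i ^ \<alpha> $ i))"


section \<open>Ideals, regular sequences, finite length\<close>

text \<open>Ideals of a commutative ring are its submodules over itself.\<close>

definition is_ideal :: "'a::comm_ring_1 set \<Rightarrow> bool" where
  "is_ideal J \<longleftrightarrow> module.subspace (*) J"

definition ideal_gen :: "'a::comm_ring_1 set \<Rightarrow> 'a set" where
  "ideal_gen S = module.span (*) S"

definition entries :: "'a^'n \<Rightarrow> 'a set" where
  "entries q = range (($) q)"

text \<open>The sequence \<open>q\<close> is listed in the order of its index type.\<close>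

definition regular_sequence :: "'a::comm_ring_1 ^ 'n::{finite,linorder} \<Rightarrow> bool" where
  "regular_sequence q \<longleftrightarrow>
     (\<forall>j r. r * q $ j \<in> ideal_gen {q $ i |i. i < j} \<longrightarrow> r \<in> ideal_gen {q $ i |i. i < j}) \<and>
     ideal_gen (entries q) \<noteq> UNIV"

text \<open>
  \<open>R/J\<close> has finite length as an \<open>R\<close>-module: strict chains of submodules of \<open>R/J\<close>, i.e. of ideals
  of \<open>R\<close> containing \<open>J\<close>, have bounded length.
\<close>

definition finite_length_quotient :: "'a::comm_ring_1 set \<Rightarrow> bool" where
  "finite_length_quotient J \<longleftrightarrow>
     (\<exists>L. \<forall>l (M :: nat \<Rightarrow> 'a set).
        (\<forall>i\<le>l. is_ideal (M i) \<and> J \<subseteq> M i) \<and> (\<forall>i<l. M i \<subset> M (Suc i)) \<longrightarrow> l \<le> L)"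


section \<open>The Grothendieck residue\<close>

text \<open>
  The residue symbol of \<open>h dx/(g\<^sub>1,\<dots>,g\<^sub>n)\<close> for a system of parameters \<open>g\<close>, as Grothendieck defined
  it.  Top local cohomology of \<open>\<Omega>\<^sup>n\<close> at the origin is the direct limit of the modules
  \<open>\<Omega>\<^sup>n/(g)\<Omega>\<^sup>n\<close> over all systems of parameters \<open>g\<close>, the transition map for \<open>g' = B g\<close> being
  multiplication by \<open>det B\<close>; the symbol denotes the class of \<open>h dx\<close> in the term of index \<open>g\<close>.
  The systems \<open>(x\<^sub>1\<^sup>\<nu>\<^sup>1\<^sup>+\<^sup>1,\<dots>,x\<^sub>n\<^sup>\<nu>\<^sup>n\<^sup>+\<^sup>1)\<close> are cofinal, and on them the residue map is the iterated
  Cauchy residue, i.e. it takes \<open>u dx\<close> to the coefficient of \<open>x\<^sup>\<nu>\<close> in \<open>u\<close>.  The analytic description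
  is \<open>(2\<pi>i)\<^sup>-\<^sup>n\<close> times the integral of \<open>h dx/(g\<^sub>1\<cdots>g\<^sub>n)\<close> over the cycle \<open>|g\<^sub>j| = \<epsilon>\<^sub>j\<close>.
  Since generators and variables have the same index type, the sign does not depend on how that
  type is ordered.
\<close>

definition residue_via :: "'n::finite cps \<Rightarrow> 'n cps ^ 'n \<Rightarrow> nat^'n \<Rightarrow> 'n cps ^ 'n ^ 'n \<Rightarrow> complex \<Rightarrow> bool"
  where
  "residue_via h g \<nu> B c \<longleftrightarrow>
     B *v g = (\<chi> i. coord i ^ Suc (\<nu> $ i)) \<and> c = coeff (det B * h) \<nu>"

definition Res0 :: "'n::finite cps \<Rightarrow> 'n cps ^ 'n \<Rightarrow> complex" where
  "Res0 h g = (THE c. \<exists>\<nu> B. residue_via h g \<nu> B c)"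


section \<open>The filtration by order along the divisor\<close>

text \<open>
  \<open>K\<close> is the set of indices of the variables \<open>z\<close> (so that \<open>D\<close> is the zero set of the product of the
  variables in \<open>K\<close>); the remaining variables are the \<open>w\<close>.  In the expansion of \<open>h\<close> in powers of
  \<open>z\<close> with coefficients in \<open>\<complex>{w}\<close>, the coefficient of a monomial is nonzero iff some
  coefficient of the full expansion lying over it is.
\<close>

definition ordD :: "'n set \<Rightarrow> 'n::finite cps \<Rightarrow> nat" where
  "ordD K h = (LEAST d. \<exists>\<alpha>. coeff h \<alpha> \<noteq> 0 \<and> mdeg K \<alpha> = d)"

lift_definition inD :: "'n set \<Rightarrow> 'n::finite cps \<Rightarrow> 'n cps" is
  "\<lambda>K a \<alpha>. if mdeg K \<alpha> = (LEAST d. \<exists>\<alpha>. a \<alpha> \<noteq> 0 \<and> mdeg K \<alpha> = d) then a \<alpha> else 0"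
proof -
  fix K and a :: "nat^'n \<Rightarrow> complex"
  assume "converges_near_0 a"
  then obtain r where r: "r > 0" "(\<lambda>\<alpha>. norm (a \<alpha>) * r ^ mdeg UNIV \<alpha>) summable_on UNIV"
    unfolding converges_near_0_def by blast
  show "converges_near_0
      (\<lambda>\<alpha>. if mdeg K \<alpha> = (LEAST d. \<exists>\<alpha>. a \<alpha> \<noteq> 0 \<and> mdeg K \<alpha> = d) then a \<alpha> else 0)"
    unfolding converges_near_0_def
    by (rule exI[of _ r], intro conjI r(1),
        rule weighted_summable_mono[OF r(2), where C=1]) (use r(1) in auto)
qed

text \<open>
  \<open>rescale K d t q\<close> is \<open>t\<^sup>-\<^sup>d q(tz,w)\<close>, for \<open>d \<le> ordD K q\<close>; written on coefficients, it makes sense at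
  \<open>t = 0\<close> as well.  No negative power of \<open>t\<close> is lost to truncated subtraction, since
  \<open>coeff q \<alpha> = 0\<close> when \<open>mdeg K \<alpha> < d\<close>.
\<close>

lift_definition rescale :: "'n set \<Rightarrow> nat \<Rightarrow> complex \<Rightarrow> 'n::finite cps \<Rightarrow> 'n cps" is
  "\<lambda>K d t a \<alpha>. t ^ (mdeg K \<alpha> - d) * a \<alpha>"
proof -
  fix K d and t :: complex and a :: "nat^'n \<Rightarrow> complex"
  assume "converges_near_0 a"
  then obtain r where r: "r > 0" "(\<lambda>\<alpha>. norm (a \<alpha>) * r ^ mdeg UNIV \<alpha>) summable_on UNIV"
    unfolding converges_near_0_def by blast
  define T where "T = max 1 (norm t)"
  have T: "T \<ge> 1" "norm t \<le> T" by (auto simp: T_def)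
  have "(\<lambda>\<alpha>. norm (t ^ (mdeg K \<alpha> - d) * a \<alpha>) * (r / T) ^ mdeg UNIV \<alpha>) summable_on UNIV"
  proof (rule weighted_summable_mono[OF r(2), where C=1])
    fix \<alpha> :: "nat^'n"
    have "norm t ^ (mdeg K \<alpha> - d) \<le> T ^ (mdeg K \<alpha> - d)"
      using T by (intro power_mono) auto
    also have "\<dots> \<le> T ^ mdeg UNIV \<alpha>"
      using T mdeg_le_UNIV[of K \<alpha>] by (intro power_increasing) auto
    finally have "norm t ^ (mdeg K \<alpha> - d) * (norm (a \<alpha>) * (r / T) ^ mdeg UNIV \<alpha>)
        \<le> T ^ mdeg UNIV \<alpha> * (norm (a \<alpha>) * (r / T) ^ mdeg UNIV \<alpha>)"
      using r(1) T by (intro mult_right_mono) auto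
    also have "\<dots> = norm (a \<alpha>) * r ^ mdeg UNIV \<alpha>"
      using T by (simp add: power_divide)
    finally show "norm (t ^ (mdeg K \<alpha> - d) * a \<alpha>) * (r / T) ^ mdeg UNIV \<alpha>
        \<le> 1 * (norm (a \<alpha>) * r ^ mdeg UNIV \<alpha>)"
      by (simp add: norm_mult norm_power mult_ac)
  qed (use r(1) T in auto)
  then show "converges_near_0 (\<lambda>\<alpha>. t ^ (mdeg K \<alpha> - d) * a \<alpha>)"
    unfolding converges_near_0_def using r(1) T by (intro exI[of _ "r / T"]) auto
qed

text \<open>\<open>h(tz,w)\<close>\<close>

abbreviation dilate :: "'n set \<Rightarrow> complex \<Rightarrow> 'n::finite cps \<Rightarrow> 'n cps" where
  "dilate K t h \<equiv> rescale K 0 t h"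


section \<open>Boundary fixed points and admissible presentations\<close>

text \<open>
  The germ at \<open>0\<close> of a self-map is the family \<open>f $ i = f\<^sup>* x\<^sub>i\<close>.  For \<open>i \<in> K\<close>, strictness says
  \<open>f\<^sup>* z\<^sub>i = z\<^sub>i a\<^sub>i\<close> with \<open>a\<^sub>i\<close> a unit.
\<close>

definition strict_log_germ :: "'n set \<Rightarrow> 'n::finite cps ^ 'n \<Rightarrow> bool" where
  "strict_log_germ K f \<longleftrightarrow>
     (\<forall>i. coeff (f $ i) 0 = 0) \<and> (\<forall>i\<in>K. \<exists>a. a dvd 1 \<and> f $ i = coord i * a)"

definition isolated_fixed_point :: "'n::finite cps ^ 'n \<Rightarrow> bool" where
  "isolated_fixed_point f \<longleftrightarrow>
     (\<exists>\<epsilon>>0. \<forall>x. norm x < \<epsilon> \<and> (\<forall>i. cps_eval (f $ i) x = x $ i) \<longrightarrow> x = 0)"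

definition fixed_point_eqs :: "'n::finite cps ^ 'n \<Rightarrow> 'n cps ^ 'n" where
  "fixed_point_eqs f = (\<chi> i. coord i - f $ i)"

definition normally_admissible ::
    "'n set \<Rightarrow> 'n cps set \<Rightarrow> 'n cps ^ 'n::{finite,linorder} \<Rightarrow> bool" where
  "normally_admissible K I q \<longleftrightarrow>
     regular_sequence q \<and> ideal_gen (entries q) = I \<and>
     finite_length_quotient (ideal_gen (entries (\<chi> j. inD K (q $ j)))) \<and>
     card K \<le> (\<Sum>j\<in>UNIV. ordD K (q $ j))"

definition excess :: "'n set \<Rightarrow> 'n::finite cps ^ 'n \<Rightarrow> nat" where
  "excess K q = (\<Sum>j\<in>UNIV. ordD K (q $ j)) - card K"

definition rescaled_residue ::
    "'n set \<Rightarrow> 'n::finite cps ^ 'n \<Rightarrow> (complex \<Rightarrow> 'n cps) \<Rightarrow> complex \<Rightarrow> complex" where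
  "rescaled_residue K q H t = Res0 (H t) (\<chi> j. rescale K (ordD K (q $ j)) t (q $ j))"

end

theory Submission
  imports Defs
begin

text \<open>
  Write \<open>x\<^sub>i\<close> for all variables, \<open>d\<^sub>j\<close> for the order of \<open>q\<^sub>j\<close> along the divisor, and \<open>zfil K p\<close> for the
  series of order at least \<open>p\<close>.  As the initial forms have finite colength, every series of large
  order \<open>p\<close> lies in the ideal they generate, and so agrees, up to order \<open>p + 1\<close>, with a combination
  \<open>\<Sum>\<^sub>j c\<^sub>j q\<^sub>j\<close> in which \<open>c\<^sub>j\<close> has order at least \<open>p - d\<^sub>j\<close>; Nakayama's lemma removes the error.  This
  produces powers \<open>x\<^sub>i\<^sup>\<nu>\<^sup>i\<^sup>+\<^sup>1 = \<Sum>\<^sub>j B\<^sub>i\<^sub>j q\<^sub>j\<close> where \<open>B\<^sub>i\<^sub>j\<close> has order at least \<open>e\<^sub>i - d\<^sub>j\<close>, \<open>e\<^sub>i\<close> being the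
  \<open>z\<close>-degree of the power.  The matrix \<open>t\<^sup>-\<^sup>(\<^sup>e\<^sup>i\<^sup>-\<^sup>d\<^sup>j\<^sup>) B\<^sub>i\<^sub>j(tz,w)\<close> then expresses the same powers through the
  rescaled generators for every \<open>t\<close>, including \<open>t = 0\<close>, and its determinant has the weight that
  turns the coefficient defining the residue into \<open>t\<^sup>e\<^sup>(\<^sup>q\<^sup>)\<close> times the residue of the original presentation.
  No convergence in \<open>t\<close> is involved.
\<close>

section \<open>Coefficients, units and monomials\<close>

lemma coeff_simps [simp]:
  "coeff 0 \<alpha> = 0" "coeff (f + g) \<alpha> = coeff f \<alpha> + coeff g \<alpha>"
  "coeff (- f) \<alpha> = - coeff f \<alpha>" "coeff (f - g) \<alpha> = coeff f \<alpha> - coeff g \<alpha>"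
  by (simp_all add: zero_cps.rep_eq plus_cps.rep_eq uminus_cps.rep_eq minus_cps_def
      del: add_uminus_conv_diff)

lemma coeff_sum [simp]: "coeff (\<Sum>i\<in>A. f i) \<alpha> = (\<Sum>i\<in>A. coeff (f i) \<alpha>)"
  by (induction A rule: infinite_finite_induct) auto

lemma coeff_mult_nz:
  assumes "coeff (f * g) \<alpha> \<noteq> 0"
  obtains \<beta> \<gamma> where "\<alpha> = \<beta> + \<gamma>" "coeff f \<beta> \<noteq> 0" "coeff g \<gamma> \<noteq> 0"
proof -
  obtain p where "p \<in> {p. fst p + snd p = \<alpha>}" "coeff f (fst p) * coeff g (snd p) \<noteq> 0"
    using assms unfolding times_cps.rep_eq by (meson sum.not_neutral_contains_not_neutral)
  then show thesis by (intro that[of "fst p" "snd p"]) auto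
qed

lemma mdeg_0 [simp]: "mdeg K 0 = 0"
  by (simp add: mdeg_def)

lemma mdeg_axis [simp]: "mdeg K (axis i n) = (if i \<in> K then n else 0)"
  by (simp add: mdeg_def axis_def)

lemma mdeg_UNIV_eq_0 [simp]: "mdeg UNIV \<alpha> = 0 \<longleftrightarrow> \<alpha> = 0"
  by (auto simp: mdeg_def vec_eq_iff)

lemma coeff_mult_0 [simp]:
  fixes f g :: "'n::finite cps"
  shows "coeff (f * g) 0 = coeff f 0 * coeff g 0"
proof -
  have "{p :: (nat^'n) \<times> (nat^'n). fst p + snd p = 0} = {(0, 0)}"
    by (auto simp: vec_eq_iff prod_eq_iff)
  then show ?thesis by (simp add: times_cps.rep_eq)
qed

section \<open>Absolute convergence from coefficient bounds, and inverses of units\<close>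

lemma summable_geometric_mdeg:
  assumes "0 \<le> s" "s < (1 :: real)"
  shows "(\<lambda>\<alpha> :: nat^'n. s ^ mdeg UNIV \<alpha>) summable_on UNIV"
proof -
  have bnd: "(\<Sum>\<alpha>\<in>F. s ^ mdeg UNIV \<alpha>) \<le> (\<Prod>i\<in>(UNIV :: 'n set). 1 / (1 - s))" if F: "finite F" for F :: "(nat^'n) set"
  proof -
    define N where "N = (\<Sum>\<alpha>\<in>F. mdeg UNIV \<alpha>)"
    have le: "\<alpha> $ i \<le> N" if "\<alpha> \<in> F" for \<alpha> i
    proof -
      have "\<alpha> $ i \<le> mdeg UNIV \<alpha>" unfolding mdeg_def by (rule member_le_sum) auto
      also have "\<dots> \<le> N" unfolding N_def using F that by (intro member_le_sum) auto
      finally show ?thesis .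
    qed
    have inj: "inj_on vec_nth F" by (auto simp: inj_on_def vec_nth_inject)
    have "(\<Sum>\<alpha>\<in>F. s ^ mdeg UNIV \<alpha>) = (\<Sum>\<phi>\<in>vec_nth ` F. \<Prod>i\<in>UNIV. s ^ \<phi> i)"
      by (subst sum.reindex[OF inj]) (simp add: mdeg_def power_sum)
    \<comment> \<open>Enlarging \<open>F\<close> to a full box lets the sum factor into one-variable
      geometric sums.\<close>
    also have "\<dots> \<le> (\<Sum>\<phi>\<in>(\<Pi>\<^sub>E i\<in>(UNIV :: 'n set). {..N}). \<Prod>i\<in>UNIV. s ^ \<phi> i)"
      using assms le by (intro sum_mono2 finite_PiE) (auto intro!: prod_nonneg)
    also have "\<dots> = (\<Prod>i\<in>(UNIV :: 'n set). \<Sum>k\<in>{..N}. s ^ k)"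
      by (subst prod_sum_PiE) auto
    also have "\<dots> \<le> (\<Prod>i\<in>(UNIV :: 'n set). 1 / (1 - s))"
    proof (intro prod_mono conjI)
      show "(\<Sum>k\<in>{..N}. s ^ k) \<le> 1 / (1 - s)"
        using assms sum_le_suminf[of "\<lambda>k. s ^ k" "{..N}"]
        by (simp add: suminf_geometric summable_geometric)
    qed (use assms in \<open>auto intro!: sum_nonneg\<close>)
    finally show ?thesis .
  qed
  show ?thesis
    by (rule nonneg_bdd_above_summable_on) (use assms bnd in \<open>auto intro!: bdd_aboveI2\<close>)
qed

text \<open>Halving the radius turns the bound into a geometric majorant, so convergence can be
  tested by a supremum instead of a sum.\<close>

lemma converges_near_0_bounded:
  fixes a :: "nat^'n \<Rightarrow> complex"
  assumes "r > 0" "\<And>\<alpha>. norm (a \<alpha>) * r ^ mdeg UNIV \<alpha> \<le> C"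
  shows "converges_near_0 a"
proof -
  have "(\<lambda>\<alpha>. norm (a \<alpha>) * (r / 2) ^ mdeg UNIV \<alpha>) summable_on UNIV"
  proof (rule summable_on_comparison_test)
    show "(\<lambda>\<alpha> :: nat^'n. C * (1 / 2) ^ mdeg UNIV \<alpha>) summable_on UNIV"
      by (intro summable_on_cmult_right summable_geometric_mdeg) auto
    show "norm (a \<alpha>) * (r / 2) ^ mdeg UNIV \<alpha> \<le> C * (1 / 2) ^ mdeg UNIV \<alpha>" for \<alpha>
      using mult_right_mono[OF assms(2)[of \<alpha>], of "(1 / 2) ^ mdeg UNIV \<alpha>"]
      by (simp add: power_divide)
  qed (use assms in auto)
  then show ?thesis using assms(1) unfolding converges_near_0_def by (intro exI[of _ "r / 2"]) auto
qed

lemma coeff_bounded: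
  fixes f :: "'n::finite cps"
  obtains r C where "r > 0" "\<And>\<alpha>. norm (coeff f \<alpha>) * r ^ mdeg UNIV \<alpha> \<le> C"
proof -
  obtain r where r: "r > 0" "(\<lambda>\<alpha>. norm (coeff f \<alpha>) * r ^ mdeg UNIV \<alpha>) summable_on UNIV"
    using coeff[of f] unfolding converges_near_0_def by blast
  have "norm (coeff f \<alpha>) * r ^ mdeg UNIV \<alpha> \<le> (\<Sum>\<^sub>\<infinity>\<beta>. norm (coeff f \<beta>) * r ^ mdeg UNIV \<beta>)" for \<alpha>
    using finite_sum_le_infsum[OF r(2), of "{\<alpha>}"] r(1) by simp
  then show thesis using that r(1) by blast
qed

lemma coeff_small_radius:
  fixes f :: "'n::finite cps"
  assumes "coeff f 0 = 0"
  obtains r where "r > 0" "(\<lambda>\<alpha>. norm (coeff f \<alpha>) * r ^ mdeg UNIV \<alpha>) summable_on UNIV"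
    "(\<Sum>\<^sub>\<infinity>\<alpha>. norm (coeff f \<alpha>) * r ^ mdeg UNIV \<alpha>) \<le> 1 / 2"
proof -
  obtain r where r: "r > 0" "(\<lambda>\<alpha>. norm (coeff f \<alpha>) * r ^ mdeg UNIV \<alpha>) summable_on UNIV"
    using coeff[of f] unfolding converges_near_0_def by blast
  define C where "C = (\<Sum>\<^sub>\<infinity>\<alpha>. norm (coeff f \<alpha>) * r ^ mdeg UNIV \<alpha>)"
  have C: "C \<ge> 0" unfolding C_def using r(1) by (intro infsum_nonneg) auto
  \<comment> \<open>A nonconstant term gains at least one factor \<open>u\<close> when the radius
    shrinks from \<open>r\<close> to \<open>u * r\<close>, so the whole sum shrinks by
    \<open>u\<close>. This choice makes \<open>u * C\<close> at most 1/2; \<open>C + 1\<close> keeps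
    the denominator positive when \<open>C = 0\<close>.\<close>
  define u where "u = 1 / (2 * (C + 1))"
  have u: "u > 0" "u \<le> 1" "u * C \<le> 1 / 2" using C by (auto simp: u_def field_simps)
  have le: "norm (coeff f \<alpha>) * (u * r) ^ mdeg UNIV \<alpha> \<le> u * (norm (coeff f \<alpha>) * r ^ mdeg UNIV \<alpha>)" for \<alpha>
  proof (cases "\<alpha> = 0")
    case False
    then have "u ^ mdeg UNIV \<alpha> \<le> u ^ 1" using u by (intro power_decreasing) (auto simp: Suc_le_eq simp flip: neq0_conv)
    then have "u ^ mdeg UNIV \<alpha> * (norm (coeff f \<alpha>) * r ^ mdeg UNIV \<alpha>) \<le> u ^ 1 * (norm (coeff f \<alpha>) * r ^ mdeg UNIV \<alpha>)"
      using r(1) by (intro mult_right_mono) auto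
    then show ?thesis by (simp add: power_mult_distrib mult_ac)
  qed (use assms in auto)
  have s: "(\<lambda>\<alpha>. norm (coeff f \<alpha>) * (u * r) ^ mdeg UNIV \<alpha>) summable_on UNIV"
    by (rule weighted_summable_mono[OF r(2), where C = u]) (use le u r in auto)
  have "(\<Sum>\<^sub>\<infinity>\<alpha>. norm (coeff f \<alpha>) * (u * r) ^ mdeg UNIV \<alpha>)
      \<le> (\<Sum>\<^sub>\<infinity>\<alpha>. u * (norm (coeff f \<alpha>) * r ^ mdeg UNIV \<alpha>))"
    by (rule infsum_mono[OF s]) (use le r(2) in \<open>auto intro: summable_on_cmult_right\<close>)
  also have "\<dots> = u * C" unfolding C_def by (rule infsum_cmult_right) (use r in auto)
  finally show thesis using that[of "u * r"] u(1,3) r(1) s by force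
qed

lemma coeff_power_eq_0:
  assumes "coeff f 0 = 0" "mdeg UNIV \<alpha> < k"
  shows "coeff (f ^ k) \<alpha> = 0"
  using assms(2)
proof (induction k arbitrary: \<alpha>)
  case (Suc k)
  show ?case
  proof (rule ccontr)
    assume "coeff (f ^ Suc k) \<alpha> \<noteq> 0"
    then obtain \<beta> \<gamma> where *: "\<alpha> = \<beta> + \<gamma>" "coeff f \<beta> \<noteq> 0" "coeff (f ^ k) \<gamma> \<noteq> 0"
      by (auto elim: coeff_mult_nz)
    then have "\<beta> \<noteq> 0" "\<not> mdeg UNIV \<gamma> < k" using assms(1) Suc.IH by auto
    then have "mdeg UNIV \<beta> > 0" "mdeg UNIV \<gamma> \<ge> k" by (auto simp flip: neq0_conv)
    then show False using Suc.prems by (simp add: *(1) mdeg_add)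
  qed
qed auto

text \<open>The induction needs only a bound on single terms of \<open>f ^ k\<close>: the remaining
  factor \<open>f\<close>, summed over all splits of the exponent, supplies the constant
  1/2.\<close>

lemma norm_coeff_power_le:
  fixes f :: "'n::finite cps"
  assumes r: "r > 0" "(\<lambda>\<alpha>. norm (coeff f \<alpha>) * r ^ mdeg UNIV \<alpha>) summable_on UNIV"
    "(\<Sum>\<^sub>\<infinity>\<alpha>. norm (coeff f \<alpha>) * r ^ mdeg UNIV \<alpha>) \<le> 1 / 2"
  shows "norm (coeff (f ^ k) \<alpha>) * r ^ mdeg UNIV \<alpha> \<le> (1 / 2) ^ k"
proof (induction k arbitrary: \<alpha>)
  case 0
  show ?case using r(1) by (simp add: one_cps.rep_eq)
next
  case (Suc k)
  let ?S = "{p. fst p + snd p = \<alpha>}"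
  have "norm (coeff (f ^ Suc k) \<alpha>) * r ^ mdeg UNIV \<alpha>
      \<le> (\<Sum>p\<in>?S. norm (coeff f (fst p) * coeff (f ^ k) (snd p))) * r ^ mdeg UNIV \<alpha>"
    using r(1) by (auto simp: times_cps.rep_eq intro!: mult_right_mono norm_sum)
  also have "\<dots> = (\<Sum>p\<in>?S. (norm (coeff f (fst p)) * r ^ mdeg UNIV (fst p)) *
      (norm (coeff (f ^ k) (snd p)) * r ^ mdeg UNIV (snd p)))"
    by (auto simp: sum_distrib_right norm_mult mdeg_add power_add intro!: sum.cong)
  also have "\<dots> \<le> (\<Sum>p\<in>?S. (norm (coeff f (fst p)) * r ^ mdeg UNIV (fst p)) * (1 / 2) ^ k)"
    using r(1) Suc.IH by (intro sum_mono mult_left_mono) auto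
  also have "\<dots> = (\<Sum>\<beta>\<in>fst ` ?S. norm (coeff f \<beta>) * r ^ mdeg UNIV \<beta>) * (1 / 2) ^ k"
    by (subst sum.reindex) (auto simp: inj_on_def sum_distrib_right prod_eq_iff)
  also have "\<dots> \<le> (1 / 2) * (1 / 2) ^ k"
  proof (rule mult_right_mono)
    have "(\<Sum>\<beta>\<in>fst ` ?S. norm (coeff f \<beta>) * r ^ mdeg UNIV \<beta>)
        \<le> (\<Sum>\<^sub>\<infinity>\<beta>. norm (coeff f \<beta>) * r ^ mdeg UNIV \<beta>)"
      using r(1) by (intro finite_sum_le_infsum r(2) finite_imageI finite_multiindex_splits) auto
    then show "(\<Sum>\<beta>\<in>fst ` ?S. norm (coeff f \<beta>) * r ^ mdeg UNIV \<beta>) \<le> 1 / 2"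
      using r(3) by linarith
  qed simp
  finally show ?case by simp
qed

text \<open>The inverse of \<open>1 - m\<close> is the Neumann series, which is finite in each coefficient.\<close>

lemma unit_one_minus:
  fixes m :: "'n::finite cps"
  assumes "coeff m 0 = 0"
  obtains v where "v * (1 - m) = 1"
proof -
  obtain r where r: "r > 0" "(\<lambda>\<alpha>. norm (coeff m \<alpha>) * r ^ mdeg UNIV \<alpha>) summable_on UNIV"
    "(\<Sum>\<^sub>\<infinity>\<alpha>. norm (coeff m \<alpha>) * r ^ mdeg UNIV \<alpha>) \<le> 1 / 2"
    using coeff_small_radius[OF assms] by blast
  define S where "S N = (\<Sum>k\<le>N. m ^ k)" for N
  define b where "b \<alpha> = coeff (S (mdeg UNIV \<alpha>)) \<alpha>" for \<alpha>
  have "norm (b \<alpha>) * r ^ mdeg UNIV \<alpha> \<le> 2" for \<alpha>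
  proof -
    have "norm (b \<alpha>) * r ^ mdeg UNIV \<alpha> \<le> (\<Sum>k\<le>mdeg UNIV \<alpha>. norm (coeff (m ^ k) \<alpha>)) * r ^ mdeg UNIV \<alpha>"
      using r(1) by (auto simp: b_def S_def intro!: mult_right_mono norm_sum)
    also have "\<dots> \<le> (\<Sum>k\<le>mdeg UNIV \<alpha>. (1 / 2) ^ k)"
      unfolding sum_distrib_right by (intro sum_mono norm_coeff_power_le r)
    also have "\<dots> \<le> 2"
      using sum_le_suminf[of "\<lambda>k. (1 / 2 :: real) ^ k" "{..mdeg UNIV \<alpha>}"]
      by (simp add: suminf_geometric summable_geometric)
    finally show ?thesis .
  qed
  then have conv: "converges_near_0 b" using converges_near_0_bounded r(1) by blast
  define v where "v = Abs_cps b"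
  \<comment> \<open>Powers beyond the degree of \<alpha> do not reach its coefficient, so one
    \<open>N\<close> can serve all terms of a product coefficient at once, and \<open>v\<close> may
    be replaced by a finite geometric sum.\<close>
  have cv: "coeff v \<alpha> = coeff (S N) \<alpha>" if "mdeg UNIV \<alpha> \<le> N" for \<alpha> N
  proof -
    have "coeff (S N) \<alpha> = (\<Sum>k\<le>N. coeff (m ^ k) \<alpha>)" by (simp add: S_def)
    also have "\<dots> = (\<Sum>k\<le>mdeg UNIV \<alpha>. coeff (m ^ k) \<alpha>)"
      using that assms by (intro sum.mono_neutral_right) (auto intro!: coeff_power_eq_0)
    finally show ?thesis using conv by (simp add: v_def Abs_cps_inverse b_def S_def)
  qed
  have "v * (1 - m) = 1"
  proof (rule cps_eqI)
    fix \<alpha> :: "nat^'n"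
    let ?N = "mdeg UNIV \<alpha>"
    have "coeff (v * (1 - m)) \<alpha> = coeff (S ?N * (1 - m)) \<alpha>"
      unfolding times_cps.rep_eq
      by (intro sum.cong refl arg_cong2[where f = "(*)"] cv) (auto simp: mdeg_add)
    also have "S ?N * (1 - m) = 1 - m ^ Suc ?N"
      unfolding S_def by (simp add: mult.commute[of _ "1 - m"] sum_gp_basic)
    also have "coeff \<dots> \<alpha> = coeff 1 \<alpha>"
      using coeff_power_eq_0[OF assms, of \<alpha> "Suc ?N"] by simp
    finally show "coeff (v * (1 - m)) \<alpha> = coeff 1 \<alpha>" .
  qed
  then show thesis by (rule that)
qed

section \<open>Monomials and division by finitely many of them\<close>

lift_definition mon :: "nat^'n \<Rightarrow> 'n::finite cps" is "\<lambda>\<beta> \<alpha>. if \<alpha> = \<beta> then 1 else 0"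
  by (simp add: converges_near_0_finite)

lemma coeff_mon_mult_shift: "coeff (mon \<beta> * f) (\<beta> + \<alpha>) = coeff f \<alpha>"
proof -
  have "coeff (mon \<beta> * f) (\<beta> + \<alpha>) =
      (\<Sum>p | fst p + snd p = \<beta> + \<alpha>. if p = (\<beta>, \<alpha>) then coeff f \<alpha> else 0)"
    unfolding times_cps.rep_eq mon.rep_eq by (rule sum.cong) auto
  also have "\<dots> = coeff f \<alpha>"
    using finite_multiindex_splits[of "\<beta> + \<alpha>"] by simp
  finally show ?thesis .
qed

lemma coeff_mon_mult_eq_0:
  assumes "\<And>\<gamma>. \<alpha> \<noteq> \<beta> + \<gamma>"
  shows "coeff (mon \<beta> * f) \<alpha> = 0"
proof (rule ccontr)
  assume "coeff (mon \<beta> * f) \<alpha> \<noteq> 0"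
  then obtain \<delta> \<gamma> where "\<alpha> = \<delta> + \<gamma>" "coeff (mon \<beta>) \<delta> \<noteq> 0" by (rule coeff_mult_nz)
  then show False using assms by (auto simp: mon.rep_eq split: if_splits)
qed

lemma mon_0: "mon 0 = 1"
  by (rule cps_eqI) (simp add: mon.rep_eq one_cps.rep_eq)

lemma mon_add: "mon (\<beta> + \<gamma>) = mon \<beta> * mon \<gamma>"
proof (rule cps_eqI)
  fix \<alpha>
  show "coeff (mon (\<beta> + \<gamma>)) \<alpha> = coeff (mon \<beta> * mon \<gamma>) \<alpha>"
  proof (cases "\<exists>\<delta>. \<alpha> = \<beta> + \<delta>")
    case True
    then show ?thesis by (auto simp: coeff_mon_mult_shift) (simp add: mon.rep_eq)
  next
    case False
    then show ?thesis by (auto simp: coeff_mon_mult_eq_0) (auto simp: mon.rep_eq)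
  qed
qed

lemma coord_power_eq_mon:
  fixes i :: "'n::finite"
  shows "coord i ^ n = mon (axis i n)"
proof (induction n)
  case 0
  have "axis i 0 = (0 :: nat^'n)" by (simp add: vec_eq_iff axis_def)
  then show ?case by (simp only: mon_0 power_0)
next
  case (Suc n)
  have "axis i (Suc n) = axis i 1 + axis i n" by (simp add: vec_eq_iff axis_def)
  moreover have "coord i = mon (axis i 1)" by (rule cps_eqI) (simp add: coord.rep_eq mon.rep_eq)
  ultimately show ?case using Suc by (simp add: mon_add)
qed

lemma coeff_coord_power_mult_eq_0:
  assumes "\<alpha> $ i < n"
  shows "coeff (coord i ^ n * f) \<alpha> = 0"
  using assms unfolding coord_power_eq_mon
  by (intro coeff_mon_mult_eq_0) (auto simp: axis_def)

text \<open>Dividing by \<open>mon \<beta>\<close> costs only the factor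
  \<open>r ^ mdeg UNIV \<beta>\<close> in the coefficient bound. The predicate \<open>P\<close>
  selects part of the series, so that its terms can be shared out among several monomials.\<close>

lemma ex_restricted_shift:
  fixes f :: "'n::finite cps"
  shows "\<exists>g. \<forall>\<alpha>. coeff g \<alpha> = (if P \<alpha> then coeff f (\<beta> + \<alpha>) else 0)"
proof -
  obtain r C where r: "r > 0" "\<And>\<alpha>. norm (coeff f \<alpha>) * r ^ mdeg UNIV \<alpha> \<le> C"
    using coeff_bounded by blast
  have "converges_near_0 (\<lambda>\<alpha>. if P \<alpha> then coeff f (\<beta> + \<alpha>) else 0)"
  proof (rule converges_near_0_bounded[OF r(1)])
    fix \<alpha> :: "nat^'n"
    have "C \<ge> 0" using r(2)[of \<alpha>] r(1) by (meson mult_nonneg_nonneg norm_ge_zero order_trans zero_le_power less_imp_le)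
    then show "norm (if P \<alpha> then coeff f (\<beta> + \<alpha>) else 0) * r ^ mdeg UNIV \<alpha> \<le> C / r ^ mdeg UNIV \<beta>"
      using r(2)[of "\<beta> + \<alpha>"] r(1) by (auto simp: mdeg_add power_add field_simps)
  qed
  then show ?thesis
    by (intro exI[of _ "Abs_cps (\<lambda>\<alpha>. if P \<alpha> then coeff f (\<beta> + \<alpha>) else 0)"]) (simp add: Abs_cps_inverse)
qed

text \<open>Each exponent is assigned to one of its divisors in \<open>T\<close>, and the terms with
  the same divisor are collected. Every coefficient is used once, so nothing cancels and order
  bounds on \<open>f\<close> pass to the quotients.\<close>

lemma monomial_decomposition:
  fixes f :: "'n::finite cps"
  assumes "finite T" "\<And>\<alpha>. coeff f \<alpha> \<noteq> 0 \<Longrightarrow> \<exists>\<beta>\<in>T. \<exists>\<gamma>. \<alpha> = \<beta> + \<gamma>"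
  obtains G where "f = (\<Sum>\<beta>\<in>T. G \<beta> * mon \<beta>)"
    "\<And>\<beta> \<alpha>. coeff (G \<beta>) \<alpha> \<noteq> 0 \<Longrightarrow> coeff f (\<beta> + \<alpha>) \<noteq> 0"
proof -
  have "\<forall>\<alpha>. \<exists>\<beta>. coeff f \<alpha> \<noteq> 0 \<longrightarrow> \<beta> \<in> T \<and> (\<exists>\<gamma>. \<alpha> = \<beta> + \<gamma>)" using assms(2) by blast
  then obtain c where c: "\<And>\<alpha>. coeff f \<alpha> \<noteq> 0 \<Longrightarrow> c \<alpha> \<in> T \<and> (\<exists>\<gamma>. \<alpha> = c \<alpha> + \<gamma>)" by metis
  have "\<forall>\<beta>. \<exists>g. \<forall>\<alpha>. coeff g \<alpha> = (if c (\<beta> + \<alpha>) = \<beta> then coeff f (\<beta> + \<alpha>) else 0)"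
    by (intro allI ex_restricted_shift)
  then obtain G where G: "\<And>\<beta> \<alpha>. coeff (G \<beta>) \<alpha> = (if c (\<beta> + \<alpha>) = \<beta> then coeff f (\<beta> + \<alpha>) else 0)"
    by metis
  have *: "coeff (G \<beta> * mon \<beta>) \<alpha> = (if c \<alpha> = \<beta> then coeff f \<alpha> else 0)" for \<beta> \<alpha>
  proof (cases "\<exists>\<gamma>. \<alpha> = \<beta> + \<gamma>")
    case True
    then obtain \<gamma> where \<gamma>: "\<alpha> = \<beta> + \<gamma>" by blast
    then show ?thesis unfolding \<gamma> using coeff_mon_mult_shift[of \<beta> "G \<beta>" \<gamma>]
      by (simp add: mult.commute[of "G \<beta>"] G)
  next
    case False
    then have "coeff (G \<beta> * mon \<beta>) \<alpha> = 0" "coeff f \<alpha> = 0 \<or> c \<alpha> \<noteq> \<beta>"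
      using c[of \<alpha>] coeff_mon_mult_eq_0[of \<alpha> \<beta> "G \<beta>"] by (metis mult.commute)+
    then show ?thesis by metis
  qed
  have "f = (\<Sum>\<beta>\<in>T. G \<beta> * mon \<beta>)"
  proof (rule cps_eqI)
    fix \<alpha>
    have "coeff (\<Sum>\<beta>\<in>T. G \<beta> * mon \<beta>) \<alpha> = (if c \<alpha> \<in> T then coeff f \<alpha> else 0)"
      using assms(1) by (simp add: *)
    then show "coeff f \<alpha> = coeff (\<Sum>\<beta>\<in>T. G \<beta> * mon \<beta>) \<alpha>" using c[of \<alpha>] by metis
  qed
  moreover have "coeff f (\<beta> + \<alpha>) \<noteq> 0" if "coeff (G \<beta>) \<alpha> \<noteq> 0" for \<beta> \<alpha>
    using that by (auto simp: G split: if_splits)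
  ultimately show thesis using that by blast
qed

section \<open>Ideals and Nakayama's lemma\<close>

lemma is_ideal_iff:
  "is_ideal J \<longleftrightarrow> 0 \<in> J \<and> (\<forall>x\<in>J. \<forall>y\<in>J. x + y \<in> J) \<and> (\<forall>c. \<forall>x\<in>J. c * x \<in> J)"
proof -
  have "module ((*) :: 'a \<Rightarrow> 'a \<Rightarrow> 'a)" by unfold_locales (simp_all add: algebra_simps)
  then show ?thesis unfolding is_ideal_def by (rule module.subspace_def)
qed

lemma is_ideal_sum:
  assumes "is_ideal J" "\<And>i. i \<in> A \<Longrightarrow> f i \<in> J"
  shows "(\<Sum>i\<in>A. c i * f i) \<in> J"
  using assms by (induction A rule: infinite_finite_induct) (auto simp: is_ideal_iff)

lemma ideal_gen_entries:
  fixes q :: "'a::comm_ring_1^'n"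
  shows "ideal_gen (entries q) = range (\<lambda>c. \<Sum>j\<in>UNIV. c j * q $ j)" (is "_ = ?W")
proof
  have m: "module ((*) :: 'a \<Rightarrow> 'a \<Rightarrow> 'a)" by unfold_locales (simp_all add: algebra_simps)
  have "is_ideal ?W"
    unfolding is_ideal_iff
  proof (intro conjI ballI allI)
    show "0 \<in> ?W" by (rule image_eqI[of _ _ "\<lambda>_. 0"]) auto
    show "x + y \<in> ?W" if x: "x \<in> ?W" and y: "y \<in> ?W" for x y
    proof -
      from x obtain c where c: "x = (\<Sum>j\<in>UNIV. c j * q $ j)" by blast
      from y obtain d where d: "y = (\<Sum>j\<in>UNIV. d j * q $ j)" by blast
      show ?thesis
        by (rule image_eqI[of _ _ "\<lambda>j. c j + d j"]) (simp_all add: c d distrib_right sum.distrib)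
    qed
    show "r * x \<in> ?W" if x: "x \<in> ?W" for r x
    proof -
      from x obtain c where c: "x = (\<Sum>j\<in>UNIV. c j * q $ j)" by blast
      show ?thesis
        by (rule image_eqI[of _ _ "\<lambda>j. r * c j"]) (simp_all add: c sum_distrib_left mult.assoc)
    qed
  qed
  moreover have "q $ j \<in> ?W" for j
  proof (rule image_eqI[of _ _ "\<lambda>i. if i = j then 1 else 0"])
    have "(\<Sum>i\<in>UNIV. (if i = j then 1 else 0) * q $ i) = (\<Sum>i\<in>UNIV. if i = j then q $ i else 0)"
      by (rule sum.cong) auto
    then show "q $ j = (\<Sum>i\<in>UNIV. (if i = j then 1 else 0) * q $ i)" by simp
  qed auto
  ultimately show "ideal_gen (entries q) \<subseteq> ?W"
    unfolding ideal_gen_def is_ideal_def entries_def by (intro module.span_minimal[OF m]) auto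
  have "(\<Sum>j\<in>UNIV. c j * q $ j) \<in> ideal_gen (entries q)" for c
    unfolding ideal_gen_def entries_def
    by (intro module.span_sum[OF m] module.span_scale[OF m] module.span_base[OF m] rangeI)
  then show "?W \<subseteq> ideal_gen (entries q)" by blast
qed

lemma is_ideal_ideal_gen: "is_ideal (ideal_gen S)"
proof -
  have "module ((*) :: 'a \<Rightarrow> 'a \<Rightarrow> 'a)" by unfold_locales (simp_all add: algebra_simps)
  then show ?thesis unfolding is_ideal_def ideal_gen_def by (rule module.subspace_span)
qed

lemma is_ideal_add_principal:
  assumes J: "is_ideal J"
  shows "is_ideal {a + r * y |a r. a \<in> J}" (is "is_ideal ?M")
  unfolding is_ideal_iff
proof (intro conjI ballI allI)
  show "0 \<in> ?M" using J by (auto simp: is_ideal_iff intro!: exI[of _ 0])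
  show "u + w \<in> ?M" if uw: "u \<in> ?M" "w \<in> ?M" for u w
  proof -
    from uw(1) obtain a r where a: "u = a + r * y" "a \<in> J" by blast
    from uw(2) obtain b s where b: "w = b + s * y" "b \<in> J" by blast
    have "u + w = (a + b) + (r + s) * y" by (simp add: a b distrib_right)
    moreover have "a + b \<in> J" using J a b by (simp add: is_ideal_iff)
    ultimately show ?thesis by blast
  qed
  show "c * u \<in> ?M" if u: "u \<in> ?M" for c u
  proof -
    from u obtain a r where a: "u = a + r * y" "a \<in> J" by blast
    have "c * u = c * a + (c * r) * y" by (simp add: a distrib_left mult.assoc)
    moreover have "c * a \<in> J" using J a by (simp add: is_ideal_iff)
    ultimately show ?thesis by blast
  qed
qed

text \<open>The ideals \<open>M i\<close>, generated by \<open>J\<close> and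
  \<open>x ^ (Suc L - i)\<close>, increase through \<open>Suc L\<close> steps, one more than the
  bound allows, so two neighbours coincide. Then \<open>x ^ (L - i)\<close> equals
  \<open>r * x\<close> times itself modulo \<open>J\<close>, and \<open>1 - r * x\<close> is a
  unit.\<close>

lemma finite_length_power_mem:
  fixes x :: "'n::finite cps"
  assumes J: "is_ideal J" and fl: "finite_length_quotient J" and x: "coeff x 0 = 0"
  obtains N where "x ^ N \<in> J"
proof -
  obtain L where L: "\<And>l M. (\<forall>i\<le>l. is_ideal (M i) \<and> J \<subseteq> M i) \<and> (\<forall>i<l. M i \<subset> M (Suc i)) \<Longrightarrow> l \<le> L"
    using fl unfolding finite_length_quotient_def by blast
  define M where "M i = {a + r * x ^ (Suc L - i) |a r. a \<in> J}" for i
  have ideal: "is_ideal (M i)" for i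
    unfolding M_def by (rule is_ideal_add_principal[OF J])
  have sub: "J \<subseteq> M i" for i
  proof
    fix a assume "a \<in> J"
    moreover have "a = a + 0 * x ^ (Suc L - i)" by simp
    ultimately show "a \<in> M i" unfolding M_def by blast
  qed
  have mem: "x ^ (Suc L - i) \<in> M i" for i
  proof -
    have "x ^ (Suc L - i) = 0 + 1 * x ^ (Suc L - i)" "0 \<in> J" using J by (auto simp: is_ideal_iff)
    then show ?thesis unfolding M_def by blast
  qed
  have step: "M i \<subseteq> M (Suc i)" if "i \<le> L" for i
  proof
    fix u assume "u \<in> M i"
    then obtain a r where ar: "u = a + r * x ^ (Suc L - i)" "a \<in> J" unfolding M_def by blast
    moreover have "x ^ (Suc L - i) = x * x ^ (Suc L - Suc i)" using that by (simp add: Suc_diff_le)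
    ultimately have "u = a + (r * x) * x ^ (Suc L - Suc i)" by (simp only: mult.assoc)
    then show "u \<in> M (Suc i)" unfolding M_def using ar(2) by blast
  qed
  have "\<not> (\<forall>i<Suc L. M i \<subset> M (Suc i))" using L[of "Suc L" M] ideal sub by (meson Suc_n_not_le_n)
  then obtain i where i: "i \<le> L" "M (Suc i) \<subseteq> M i" using step by (auto simp: less_Suc_eq_le)
  then have "x ^ (L - i) \<in> M i" using mem[of "Suc i"] by auto
  then obtain a r where ar: "x ^ (L - i) = a + r * x ^ Suc (L - i)" "a \<in> J"
    unfolding M_def using i(1) by (auto simp: Suc_diff_le)
  obtain v where v: "v * (1 - r * x) = 1" using unit_one_minus[of "r * x"] x by auto
  have "x ^ (L - i) = (v * (1 - r * x)) * x ^ (L - i)" by (simp add: v)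
  also have "\<dots> = v * (x ^ (L - i) - r * x ^ Suc (L - i))" by (simp add: algebra_simps)
  also have "\<dots> = v * a" using ar(1) by (metis add_diff_cancel_right')
  also have "\<dots> \<in> J" using J ar(2) by (auto simp: is_ideal_iff)
  finally show thesis by (rule that)
qed

text \<open>Induction eliminates one generator: the relation for \<open>s\<close> is solved for
  \<open>\<gamma> s\<close> modulo \<open>W\<close>, since \<open>1 - m s\<close> is a unit, and
  substituted into the other relations, whose coefficients keep vanishing constant terms.\<close>

lemma nakayama:
  fixes \<gamma> :: "'i \<Rightarrow> 'n::finite cps"
  assumes "finite I" "is_ideal W"
    and "\<And>s. s \<in> I \<Longrightarrow> \<exists>m. (\<forall>u. coeff (m u) 0 = 0) \<and> \<gamma> s - (\<Sum>u\<in>I. m u * \<gamma> u) \<in> W"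
  shows "\<forall>s\<in>I. \<gamma> s \<in> W"
  using assms(1,3)
proof (induction I rule: finite_induct)
  case (insert s I)
  note W = assms(2)[unfolded is_ideal_iff]
  obtain m where m: "\<And>u. coeff (m u) 0 = 0" "\<gamma> s - (\<Sum>u\<in>insert s I. m u * \<gamma> u) \<in> W"
    using insert.prems[of s] by auto
  obtain v where v: "v * (1 - m s) = 1" using unit_one_minus m(1) by blast
  have "v * (\<gamma> s - (\<Sum>u\<in>insert s I. m u * \<gamma> u)) \<in> W" using m(2) W by blast
  also have "v * (\<gamma> s - (\<Sum>u\<in>insert s I. m u * \<gamma> u)) = (v * (1 - m s)) * \<gamma> s - v * (\<Sum>u\<in>I. m u * \<gamma> u)"
    using insert.hyps by (simp add: algebra_simps)
  finally have s: "\<gamma> s - v * (\<Sum>u\<in>I. m u * \<gamma> u) \<in> W" by (simp add: v)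
  have "\<forall>t\<in>I. \<gamma> t \<in> W"
  proof (rule insert.IH)
    fix t assume "t \<in> I"
    then obtain m' where m': "\<And>u. coeff (m' u) 0 = 0" "\<gamma> t - (\<Sum>u\<in>insert s I. m' u * \<gamma> u) \<in> W"
      using insert.prems[of t] by auto
    have "(\<gamma> t - (\<Sum>u\<in>insert s I. m' u * \<gamma> u)) + m' s * (\<gamma> s - v * (\<Sum>u\<in>I. m u * \<gamma> u)) \<in> W"
      using m'(2) s W by blast
    also have "(\<gamma> t - (\<Sum>u\<in>insert s I. m' u * \<gamma> u)) + m' s * (\<gamma> s - v * (\<Sum>u\<in>I. m u * \<gamma> u))
        = \<gamma> t - (\<Sum>u\<in>I. (m' u + m' s * v * m u) * \<gamma> u)"
      using insert.hyps by (simp add: algebra_simps sum.distrib sum_distrib_left)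
    finally show "\<exists>m. (\<forall>u. coeff (m u) 0 = 0) \<and> \<gamma> t - (\<Sum>u\<in>I. m u * \<gamma> u) \<in> W"
      using m m' by (intro exI[of _ "\<lambda>u. m' u + m' s * v * m u"]) auto
  qed
  moreover have "\<gamma> s \<in> W"
  proof -
    have "(\<Sum>u\<in>I. m u * \<gamma> u) \<in> W" using calculation by (intro is_ideal_sum[OF assms(2)]) auto
    then have "(\<gamma> s - v * (\<Sum>u\<in>I. m u * \<gamma> u)) + v * (\<Sum>u\<in>I. m u * \<gamma> u) \<in> W" using s W by blast
    then show ?thesis by simp
  qed
  ultimately show ?case by simp
qed auto

section \<open>Presentations compatible with the order along the divisor\<close>

text \<open>The index is an integer because weights such as \<open>p - int (d j)\<close> may be
  negative, in which case there is no condition. The coefficientwise form also admits the zero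
  series.\<close>

definition zfil :: "'n set \<Rightarrow> int \<Rightarrow> 'n::finite cps set" where
  "zfil K k = {f. \<forall>\<alpha>. coeff f \<alpha> \<noteq> 0 \<longrightarrow> k \<le> int (mdeg K \<alpha>)}"

lemma zfilD: "f \<in> zfil K k \<Longrightarrow> coeff f \<alpha> \<noteq> 0 \<Longrightarrow> k \<le> int (mdeg K \<alpha>)"
  by (simp add: zfil_def)

lemma zfil_antimono: "f \<in> zfil K k \<Longrightarrow> l \<le> k \<Longrightarrow> f \<in> zfil K l"
  by (force simp: zfil_def)

lemma zfil_nonpos: "k \<le> 0 \<Longrightarrow> f \<in> zfil K k"
  by (simp add: zfil_def)

lemma zfil_mult: "f \<in> zfil K k \<Longrightarrow> g \<in> zfil K l \<Longrightarrow> f * g \<in> zfil K (k + l)"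
proof -
  assume f: "f \<in> zfil K k" and g: "g \<in> zfil K l"
  have "k + l \<le> int (mdeg K \<alpha>)" if nz: "coeff (f * g) \<alpha> \<noteq> 0" for \<alpha>
  proof -
    obtain \<beta> \<gamma> where "\<alpha> = \<beta> + \<gamma>" "coeff f \<beta> \<noteq> 0" "coeff g \<gamma> \<noteq> 0"
      using nz by (rule coeff_mult_nz)
    then show ?thesis using zfilD[OF f, of \<beta>] zfilD[OF g, of \<gamma>] by (simp add: mdeg_add)
  qed
  then show ?thesis by (simp add: zfil_def)
qed

lemma zfil_mult_right: "g \<in> zfil K l \<Longrightarrow> f * g \<in> zfil K l"
  using zfil_mult[of f K 0 g l] by (simp add: zfil_nonpos)

lemma zfil_add: "f \<in> zfil K k \<Longrightarrow> g \<in> zfil K k \<Longrightarrow> f + g \<in> zfil K k"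
  by (smt (verit) add_0 coeff_simps(2) mem_Collect_eq zfil_def)

lemma is_ideal_zfil: "is_ideal (zfil K k)"
  unfolding is_ideal_iff by (intro conjI ballI allI zfil_add zfil_mult_right) (simp add: zfil_def)

lemma zfil_diff: "f \<in> zfil K k \<Longrightarrow> g \<in> zfil K k \<Longrightarrow> f - g \<in> zfil K k"
  using zfil_add[of f K k "-1 * g"] zfil_mult_right[of g K k "-1"] by simp

lemma zfil_sum: "(\<And>i. i \<in> A \<Longrightarrow> f i \<in> zfil K k) \<Longrightarrow> (\<Sum>i\<in>A. f i) \<in> zfil K k"
  using is_ideal_sum[OF is_ideal_zfil, of A f K k "\<lambda>_. 1"] by simp

lemma zfil_prod: "(\<And>i. i \<in> A \<Longrightarrow> f i \<in> zfil K (k i)) \<Longrightarrow> (\<Prod>i\<in>A. f i) \<in> zfil K (\<Sum>i\<in>A. k i)"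
  by (induction A rule: infinite_finite_induct) (auto intro: zfil_mult zfil_nonpos)

lemma zfil_power: "f \<in> zfil K k \<Longrightarrow> f ^ n \<in> zfil K (int n * k)"
  using zfil_prod[of "{..<n}" "\<lambda>_. f" K "\<lambda>_. k"] by simp

text \<open>The initial form is the case \<open>d = ordD K f\<close>; with \<open>d\<close> fixed
  the map is additive, which the initial form in general is not.\<close>

lift_definition hpart :: "'n set \<Rightarrow> nat \<Rightarrow> 'n::finite cps \<Rightarrow> 'n cps" is
  "\<lambda>K d a \<alpha>. if mdeg K \<alpha> = d then a \<alpha> else 0"
proof -
  fix K d and a :: "nat^'n \<Rightarrow> complex"
  assume "converges_near_0 a"
  then obtain r where r: "r > 0" "(\<lambda>\<alpha>. norm (a \<alpha>) * r ^ mdeg UNIV \<alpha>) summable_on UNIV"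
    unfolding converges_near_0_def by blast
  have "(\<lambda>\<alpha>. norm (if mdeg K \<alpha> = d then a \<alpha> else 0) * r ^ mdeg UNIV \<alpha>) summable_on UNIV"
    by (rule weighted_summable_mono[OF r(2), where C = 1]) (use r(1) in auto)
  then show "converges_near_0 (\<lambda>\<alpha>. if mdeg K \<alpha> = d then a \<alpha> else 0)"
    unfolding converges_near_0_def using r(1) by blast
qed

lemma hpart_in_zfil: "hpart K d f \<in> zfil K (int d)"
  by (simp add: zfil_def hpart.rep_eq)

lemma diff_hpart_in_zfil: "f \<in> zfil K (int d) \<Longrightarrow> f - hpart K d f \<in> zfil K (int d + 1)"
  unfolding zfil_def by (auto simp: hpart.rep_eq le_less)

lemma hpart_sum: "hpart K p (\<Sum>i\<in>A. f i) = (\<Sum>i\<in>A. hpart K p (f i))"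
  by (rule cps_eqI) (simp add: hpart.rep_eq)

lemma hpart_mult_hpart:
  "hpart K p (f * hpart K d g) = (if d \<le> p then hpart K (p - d) f * hpart K d g else 0)"
proof (rule cps_eqI)
  fix \<alpha>
  have "coeff (hpart K p (f * hpart K d g)) \<alpha> =
      (\<Sum>x | fst x + snd x = \<alpha>. if mdeg K \<alpha> = p then coeff f (fst x) * coeff (hpart K d g) (snd x) else 0)"
    by (simp add: hpart.rep_eq times_cps.rep_eq)
  also have "\<dots> = (\<Sum>x | fst x + snd x = \<alpha>.
      if d \<le> p then coeff (hpart K (p - d) f) (fst x) * coeff (hpart K d g) (snd x) else 0)"
    by (intro sum.cong refl) (auto simp: hpart.rep_eq mdeg_add)
  also have "\<dots> = coeff (if d \<le> p then hpart K (p - d) f * hpart K d g else 0) \<alpha>"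
    by (simp add: times_cps.rep_eq)
  finally show "coeff (hpart K p (f * hpart K d g)) \<alpha> = \<dots>" .
qed

text \<open>For \<open>f = 0\<close> the value of \<open>ordD\<close> is an unspecified number; this
  does no harm, as the zero series lies in every step of the filtration.\<close>

lemma in_zfil_ordD: "f \<in> zfil K (int (ordD K f))"
  unfolding zfil_def ordD_def by (auto intro: Least_le)

lemma inD_eq_hpart: "inD K f = hpart K (ordD K f) f"
  by (rule cps_eqI) (simp add: inD.rep_eq hpart.rep_eq ordD_def)

definition zmonomials :: "'n set \<Rightarrow> nat \<Rightarrow> (nat^'n::finite) set" where
  "zmonomials K p = {\<beta>. (\<forall>i. i \<notin> K \<longrightarrow> \<beta> $ i = 0) \<and> mdeg K \<beta> = p}"

lemma finite_zmonomials: "finite (zmonomials K p)"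
proof (rule finite_subset[OF _ finite_multiindex_le])
  show "zmonomials K p \<subseteq> {\<beta>. \<forall>i. \<beta> $ i \<le> (\<chi> i. p) $ i}"
  proof (safe, simp)
    fix \<beta> :: "nat^'a" and i assume \<beta>: "\<beta> \<in> zmonomials K p"
    show "\<beta> $ i \<le> p"
    proof (cases "i \<in> K")
      case True
      then have "\<beta> $ i \<le> mdeg K \<beta>" unfolding mdeg_def by (intro member_le_sum) auto
      then show ?thesis using \<beta> by (simp add: zmonomials_def)
    qed (use \<beta> in \<open>simp add: zmonomials_def\<close>)
  qed
qed

lemma zmonomials_dvd:
  assumes "p \<le> mdeg K \<alpha>"
  shows "\<exists>\<beta>\<in>zmonomials K p. \<exists>\<gamma>. \<alpha> = \<beta> + \<gamma>"
  using assms
proof (induction p)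
  case 0
  show ?case by (rule bexI[of _ 0]) (auto simp: zmonomials_def)
next
  case (Suc p)
  then obtain \<beta> \<gamma> where \<beta>: "\<beta> \<in> zmonomials K p" "\<alpha> = \<beta> + \<gamma>" by auto
  then have "mdeg K \<gamma> > 0" using Suc.prems by (simp add: zmonomials_def mdeg_add)
  then obtain i where i: "i \<in> K" "\<gamma> $ i > 0"
    unfolding mdeg_def by (metis not_gr_zero sum.neutral)
  show ?case
  proof (intro bexI exI)
    show "\<alpha> = (\<beta> + axis i 1) + (\<chi> j. if j = i then \<gamma> $ j - 1 else \<gamma> $ j)"
      using i by (auto simp: \<beta>(2) vec_eq_iff axis_def)
    show "\<beta> + axis i 1 \<in> zmonomials K (Suc p)"
      using \<beta>(1) i by (auto simp: zmonomials_def mdeg_add) (auto simp: axis_def)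
  qed
qed

text \<open>The case \<open>l = 0\<close> says that the monomials generate; \<open>l = 1\<close>
  puts the coefficients into the maximal ideal, as Nakayama's lemma requires.\<close>

lemma zfil_decomposition:
  assumes "f \<in> zfil K (int p + int l)"
  obtains G where "f = (\<Sum>\<beta>\<in>zmonomials K p. G \<beta> * mon \<beta>)" "\<And>\<beta>. \<beta> \<in> zmonomials K p \<Longrightarrow> G \<beta> \<in> zfil K l"
proof -
  have "\<exists>\<beta>\<in>zmonomials K p. \<exists>\<gamma>. \<alpha> = \<beta> + \<gamma>" if "coeff f \<alpha> \<noteq> 0" for \<alpha>
    using zfilD[OF assms that] by (intro zmonomials_dvd) auto
  then obtain G where G: "f = (\<Sum>\<beta>\<in>zmonomials K p. G \<beta> * mon \<beta>)"
    "\<And>\<beta> \<alpha>. coeff (G \<beta>) \<alpha> \<noteq> 0 \<Longrightarrow> coeff f (\<beta> + \<alpha>) \<noteq> 0"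
    using monomial_decomposition[OF finite_zmonomials, of f K p] by blast
  have "G \<beta> \<in> zfil K l" if "\<beta> \<in> zmonomials K p" for \<beta>
    unfolding zfil_def
  proof (intro CollectI allI impI)
    fix \<alpha> assume "coeff (G \<beta>) \<alpha> \<noteq> 0"
    then show "int l \<le> int (mdeg K \<alpha>)"
      using that zfilD[OF assms G(2)] by (fastforce simp: zmonomials_def mdeg_add)
  qed
  then show thesis using that G(1) by blast
qed

text \<open>When \<open>q $ j\<close> has order at least \<open>d j\<close>, every single summand
  here has order at least \<open>p\<close>: cancellation of lower orders is excluded. This control
  of the coefficients is what makes rescaling possible.\<close>

definition zspan :: "'n set \<Rightarrow> ('n \<Rightarrow> nat) \<Rightarrow> 'n::finite cps^'n \<Rightarrow> int \<Rightarrow> 'n cps set" where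
  "zspan K d q p = {\<Sum>j\<in>UNIV. c j * q $ j |c. \<forall>j. c j \<in> zfil K (p - int (d j))}"

lemma zspanI: "(\<And>j. c j \<in> zfil K (p - int (d j))) \<Longrightarrow> (\<Sum>j\<in>UNIV. c j * q $ j) \<in> zspan K d q p"
  unfolding zspan_def by blast

lemma is_ideal_zspan: "is_ideal (zspan K d q p)"
  unfolding is_ideal_iff
proof (intro conjI ballI allI)
  show "0 \<in> zspan K d q p"
    using zspanI[of "\<lambda>_. 0" K p d q] by (simp add: zfil_def)
  show "x + y \<in> zspan K d q p" if x: "x \<in> zspan K d q p" and y: "y \<in> zspan K d q p" for x y
  proof -
    obtain c where c: "x = (\<Sum>j\<in>UNIV. c j * q $ j)" "\<And>j. c j \<in> zfil K (p - int (d j))"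
      using x unfolding zspan_def by auto
    obtain e where e: "y = (\<Sum>j\<in>UNIV. e j * q $ j)" "\<And>j. e j \<in> zfil K (p - int (d j))"
      using y unfolding zspan_def by auto
    show ?thesis
      using zspanI[of "\<lambda>j. c j + e j" K p d q] c(2) e(2)
      by (simp add: c(1) e(1) distrib_right sum.distrib zfil_add)
  qed
  show "r * x \<in> zspan K d q p" if x: "x \<in> zspan K d q p" for r x
  proof -
    obtain c where c: "x = (\<Sum>j\<in>UNIV. c j * q $ j)" "\<And>j. c j \<in> zfil K (p - int (d j))"
      using x unfolding zspan_def by auto
    show ?thesis
      using zspanI[of "\<lambda>j. r * c j" K p d q] c(2)
      by (simp add: c(1) sum_distrib_left mult.assoc zfil_mult_right)
  qed
qed

lemma zspan_subset_ideal_gen: "zspan K d q p \<subseteq> ideal_gen (entries q)"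
  unfolding ideal_gen_entries zspan_def by blast

lemma zfil_subset_zspan_step:
  assumes q: "\<And>j. q $ j \<in> zfil K (int (d j))"
    and f: "f \<in> zfil K (int p)" "f \<in> ideal_gen (entries (\<chi> j. hpart K (d j) (q $ j)))"
  obtains w where "w \<in> zspan K d q (int p)" "f - w \<in> zfil K (int p + 1)"
proof -
  obtain c where c: "f = (\<Sum>j\<in>UNIV. c j * hpart K (d j) (q $ j))"
    using f(2) by (auto simp: ideal_gen_entries)
  \<comment> \<open>Only the part of \<open>c j\<close> of degree \<open>p - d j\<close> contributes
    in degree \<open>p\<close>, and where \<open>d j\<close> exceeds \<open>p\<close> there is none.
    Replacing the initial forms by the \<open>q $ j\<close> then changes the sum only in order
    \<open>p + 1\<close> and above.\<close>
  define c' where "c' j = (if d j \<le> p then hpart K (p - d j) (c j) else 0)" for j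
  have c': "c' j \<in> zfil K (int p - int (d j))" for j
    using hpart_in_zfil[of K "p - d j" "c j"]
    by (auto simp: c'_def of_nat_diff zfil_nonpos)
  have h: "hpart K p f = (\<Sum>j\<in>UNIV. c' j * hpart K (d j) (q $ j))"
    by (auto simp: c hpart_sum hpart_mult_hpart c'_def intro!: sum.cong)
  define w where "w = (\<Sum>j\<in>UNIV. c' j * q $ j)"
  have "f - w = (f - hpart K p f) - (\<Sum>j\<in>UNIV. c' j * (q $ j - hpart K (d j) (q $ j)))"
    by (simp add: h w_def right_diff_distrib sum_subtractf)
  also have "\<dots> \<in> zfil K (int p + 1)"
  proof (rule zfil_diff[OF diff_hpart_in_zfil[OF f(1)]], rule zfil_sum)
    fix j
    show "c' j * (q $ j - hpart K (d j) (q $ j)) \<in> zfil K (int p + 1)"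
      using zfil_mult[OF c'[of j] diff_hpart_in_zfil[OF q[of j]]] by simp
  qed
  finally show thesis using that zspanI[of c' K "int p" d q, OF c'] unfolding w_def by blast
qed

text \<open>Nakayama's lemma applies since \<open>zfil K (p + 1)\<close> is contained in the maximal ideal times
  \<open>zfil K p\<close>, which is generated by \<open>zmonomials K p\<close>.\<close>

lemma zfil_subset_zspan:
  assumes q: "\<And>j. q $ j \<in> zfil K (int (d j))"
    and sub: "zfil K (int p) \<subseteq> ideal_gen (entries (\<chi> j. hpart K (d j) (q $ j)))"
  shows "zfil K (int p) \<subseteq> zspan K d q (int p)"
proof -
  have "\<forall>\<beta>\<in>zmonomials K p. mon \<beta> \<in> zspan K d q (int p)"
  proof (rule nakayama[OF finite_zmonomials is_ideal_zspan])
    fix \<beta> assume "\<beta> \<in> zmonomials K p"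
    then have m: "mon \<beta> \<in> zfil K (int p)" by (simp add: zfil_def mon.rep_eq zmonomials_def)
    obtain w where w: "w \<in> zspan K d q (int p)" "mon \<beta> - w \<in> zfil K (int p + 1)"
      by (rule zfil_subset_zspan_step[OF q m]) (use m sub in auto)
    obtain G where G: "mon \<beta> - w = (\<Sum>\<beta>\<in>zmonomials K p. G \<beta> * mon \<beta>)"
      "\<And>\<beta>. \<beta> \<in> zmonomials K p \<Longrightarrow> G \<beta> \<in> zfil K 1"
      using zfil_decomposition[of "mon \<beta> - w" K p 1] w(2) by auto
    \<comment> \<open>The extension by zero gives a vanishing constant term at every index, as
      \<open>nakayama\<close> asks.\<close>
    define m where "m \<beta> = (if \<beta> \<in> zmonomials K p then G \<beta> else 0)" for \<beta>
    have "coeff (m u) 0 = 0" for u using G(2)[of u] zfilD[of "G u" K 1 0] by (auto simp: m_def)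
    moreover have "(\<Sum>u\<in>zmonomials K p. m u * mon u) = mon \<beta> - w"
      by (simp add: G(1) m_def)
    ultimately show "\<exists>m. (\<forall>u. coeff (m u) 0 = 0) \<and>
        mon \<beta> - (\<Sum>u\<in>zmonomials K p. m u * mon u) \<in> zspan K d q (int p)"
      using w(1) by (intro exI[of _ m]) simp
  qed
  moreover have "f \<in> zspan K d q (int p)" if "f \<in> zfil K (int p)"
    "\<forall>\<beta>\<in>zmonomials K p. mon \<beta> \<in> zspan K d q (int p)" for f
  proof -
    obtain G where "f = (\<Sum>\<beta>\<in>zmonomials K p. G \<beta> * mon \<beta>)"
      using zfil_decomposition[of f K p 0] \<open>f \<in> zfil K (int p)\<close> by auto
    then show ?thesis using that(2) by (auto intro: is_ideal_sum[OF is_ideal_zspan])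
  qed
  ultimately show ?thesis by blast
qed

text \<open>Pigeonhole: a z-degree above \<open>card K * N\<close> forces some variable of
  \<open>K\<close> to occur with exponent at least \<open>N\<close>.\<close>

lemma zfil_subset_ideal:
  assumes J: "is_ideal J" and N: "\<And>i. i \<in> K \<Longrightarrow> coord i ^ N \<in> J"
  shows "zfil K (int (card K * N + 1)) \<subseteq> J"
proof
  fix f :: "'a cps" assume f: "f \<in> zfil K (int (card K * N + 1))"
  have ex: "\<exists>\<beta>\<in>(\<lambda>i. axis i N) ` K. \<exists>\<gamma>. \<alpha> = \<beta> + \<gamma>" if "coeff f \<alpha> \<noteq> 0" for \<alpha>
  proof -
    have "\<exists>i\<in>K. N \<le> \<alpha> $ i"
    proof (rule ccontr)
      assume "\<not> ?thesis"
      then have "mdeg K \<alpha> \<le> card K * N"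
        unfolding mdeg_def using sum_bounded_above[of K "($) \<alpha>" N] by force
      then show False using zfilD[OF f that] by simp
    qed
    then obtain i where i: "i \<in> K" "N \<le> \<alpha> $ i" by blast
    have "\<alpha> = axis i N + (\<chi> j. if j = i then \<alpha> $ j - N else \<alpha> $ j)"
      using i by (auto simp: vec_eq_iff axis_def)
    then show ?thesis using i(1) by blast
  qed
  obtain G where "f = (\<Sum>\<beta>\<in>(\<lambda>i. axis i N) ` K. G \<beta> * mon \<beta>)"
    using monomial_decomposition[of "(\<lambda>i. axis i N) ` K" f] ex by auto
  moreover have "mon \<beta> \<in> J" if "\<beta> \<in> (\<lambda>i. axis i N) ` K" for \<beta>
    using that N by (auto simp flip: coord_power_eq_mon)
  ultimately show "f \<in> J" by (auto intro: is_ideal_sum[OF J])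
qed

lemma is_ideal_power_mono:
  assumes "is_ideal J" "x ^ m \<in> J" "m \<le> n"
  shows "x ^ n \<in> J"
proof -
  have "x ^ n = x ^ (n - m) * x ^ m" using assms(3) by (simp flip: power_add)
  then show ?thesis using assms(1,2) by (simp add: is_ideal_iff)
qed

lemma ideal_power_of_power_diff:
  assumes J: "is_ideal J" and "x - y \<in> J" "y ^ n \<in> J"
  shows "x ^ n \<in> J"
proof -
  have "x ^ n = (\<Sum>i<n. y ^ (n - Suc i) * x ^ i) * (x - y) + y ^ n"
    using power_diff_sumr2[of x n y] by (simp only: mult.commute diff_eq_eq)
  then show ?thesis using assms by (simp add: is_ideal_iff)
qed

text \<open>For a variable of \<open>K\<close>, a power beyond \<open>P\<close> lies in
  \<open>zspan\<close>, which gives the weights. For the other variables the required weight is at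
  most 0, so it is enough to find a power in the ideal of \<open>q\<close>.\<close>

lemma graded_presentation_of_powers:
  fixes q :: "'n::finite cps^'n"
  assumes q: "\<And>j. q $ j \<in> zfil K (int (d j))"
    and fl: "finite_length_quotient (ideal_gen (entries (\<chi> j. hpart K (d j) (q $ j))))"
  obtains B \<nu> where "B *v q = (\<chi> i. coord i ^ Suc (\<nu> $ i))"
    "\<forall>i j. B $ i $ j \<in> zfil K (int (if i \<in> K then Suc (\<nu> $ i) else 0) - int (d j))"
proof -
  define J where "J = ideal_gen (entries (\<chi> j. hpart K (d j) (q $ j)))"
  define I where "I = ideal_gen (entries q)"
  have ideals: "is_ideal J" "is_ideal I" by (simp_all add: J_def I_def is_ideal_ideal_gen)
  have "\<exists>N. coord i ^ N \<in> J" for i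
  proof -
    have "coeff (coord i) 0 = 0" by (auto simp: coord.rep_eq axis_def vec_eq_iff)
    then show ?thesis
      using finite_length_power_mem[OF ideals(1) fl[folded J_def]] by blast
  qed
  then obtain n where n: "\<And>i. coord i ^ n i \<in> J" by metis
  define N where "N = (\<Sum>i\<in>UNIV. n i)"
  have N: "coord i ^ N \<in> J" for i
    by (rule is_ideal_power_mono[OF ideals(1) n[of i]]) (auto simp: N_def intro: member_le_sum)
  define P where "P = card K * N + 1"
  have span: "zfil K (int p) \<subseteq> zspan K d q (int p)" if "P \<le> p" for p
  proof (rule zfil_subset_zspan[OF q])
    have "zfil K (int p) \<subseteq> zfil K (int P)" using that zfil_antimono by fastforce
    then show "zfil K (int p) \<subseteq> ideal_gen (entries (\<chi> j. hpart K (d j) (q $ j)))"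
      using zfil_subset_ideal[OF ideals(1), of K N] N by (simp add: P_def J_def)
  qed
  define s where "s i = (if i \<in> K then P else N * P)" for i
  have "\<exists>c. coord i ^ Suc (s i) = (\<Sum>j\<in>UNIV. c j * q $ j) \<and>
      (\<forall>j. c j \<in> zfil K (int (if i \<in> K then Suc (s i) else 0) - int (d j)))" for i
  proof (cases "i \<in> K")
    case True
    have "coord i ^ Suc P \<in> zfil K (int (Suc P))"
      using True by (simp add: zfil_def coord_power_eq_mon mon.rep_eq del: power_Suc)
    then have "coord i ^ Suc P \<in> zspan K d q (int (Suc P))" using span[of "Suc P"] by auto
    then show ?thesis using True by (auto simp: s_def zspan_def)
  next
    case False
    obtain c where c: "coord i ^ N = (\<Sum>j\<in>UNIV. c j * hpart K (d j) (q $ j))"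
      using N[of i] by (auto simp: J_def ideal_gen_entries)
    \<comment> \<open>\<open>w\<close> lifts the relation from the initial forms to
      \<open>q\<close>. It lies in the ideal of \<open>q\<close> and differs from the power by order
      at least 1, so the \<open>P\<close>-th power of the difference has order at least
      \<open>P\<close> and lies in that ideal too.\<close>
    define w where "w = (\<Sum>j\<in>UNIV. c j * q $ j)"
    have "w - coord i ^ N = (\<Sum>j\<in>UNIV. c j * (q $ j - hpart K (d j) (q $ j)))"
      by (simp add: w_def c right_diff_distrib sum_subtractf)
    also have "\<dots> \<in> zfil K 1"
    proof (intro zfil_sum zfil_mult_right)
      show "q $ j - hpart K (d j) (q $ j) \<in> zfil K 1" for j
        using diff_hpart_in_zfil[OF q[of j]] by (rule zfil_antimono) simp
    qed
    finally have "w - coord i ^ N \<in> zfil K 1" .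
    then have "coord i ^ N - w \<in> zfil K 1" using zfil_mult_right[of _ K 1 "-1"] by fastforce
    then have "(coord i ^ N - w) ^ P \<in> zfil K (int P)" using zfil_power[of _ K 1 P] by simp
    then have "(coord i ^ N - w) ^ P \<in> I"
      unfolding I_def using span[of P] zspan_subset_ideal_gen by blast
    moreover have "w \<in> I" unfolding I_def ideal_gen_entries w_def by (rule rangeI)
    ultimately have "(coord i ^ N) ^ P \<in> I"
      using ideal_power_of_power_diff[OF ideals(2), of "coord i ^ N" "coord i ^ N - w" P]
      unfolding diff_diff_eq2 by simp
    then have "coord i ^ Suc (N * P) \<in> I"
      using is_ideal_power_mono[OF ideals(2), of "coord i" "N * P" "Suc (N * P)"]
      unfolding power_mult by simp
    then obtain e where e: "coord i ^ Suc (N * P) = (\<Sum>j\<in>UNIV. e j * q $ j)"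
      unfolding I_def ideal_gen_entries by blast
    show ?thesis
      by (intro exI[of _ e] conjI allI zfil_nonpos) (use False e in \<open>simp_all add: s_def\<close>)
  qed
  then obtain b where b: "\<And>i. coord i ^ Suc (s i) = (\<Sum>j\<in>UNIV. b i j * q $ j)"
    "\<And>i j. b i j \<in> zfil K (int (if i \<in> K then Suc (s i) else 0) - int (d j))"
    by metis
  show thesis
  proof (rule that[of "\<chi> i j. b i j" "\<chi> i. s i"])
    show "(\<chi> i j. b i j) *v q = (\<chi> i. coord i ^ Suc ((\<chi> i. s i) $ i))"
      by (simp add: vec_eq_iff matrix_vector_mult_def b(1) del: power_Suc)
  qed (simp only: vec_lambda_beta b(2) simp_thms)
qed

section \<open>Independence of the residue of the presentation\<close>

text \<open>Cramer's rule without division: \<open>M *v x\<close> is a combination of the columns of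
  \<open>M\<close>, and in place of column \<open>m\<close> all but the \<open>m\<close>-th summand
  produce a repeated column. The transpose appears because multilinearity is used in the
  rows.\<close>

lemma det_mult_vec:
  fixes M :: "'a::comm_ring_1^'n^'n"
  shows "x $ m * det M = det (\<chi> j. if j = m then M *v x else transpose M $ j)"
proof -
  let ?N = "transpose M"
  have "M *v x = (\<Sum>l\<in>UNIV. x $ l *s ?N $ l)"
    by (simp add: vec_eq_iff matrix_vector_mult_def transpose_def mult.commute)
  then have "det (\<chi> j. if j = m then M *v x else ?N $ j)
      = (\<Sum>l\<in>UNIV. det (\<chi> j. if j = m then x $ l *s ?N $ l else ?N $ j))"
    using det_linear_row_sum[of "UNIV :: 'n set" m "\<lambda>_ l. x $ l *s ?N $ l" "\<lambda>j. ?N $ j"]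
    by (simp cong: if_cong)
  also have "\<dots> = (\<Sum>l\<in>UNIV. x $ l * det (\<chi> j. if j = m then ?N $ l else ?N $ j))"
    by (intro sum.cong refl det_row_mul)
  also have "\<dots> = (\<Sum>l\<in>UNIV. if l = m then x $ m * det M else 0)"
  proof (intro sum.cong refl)
    fix l
    show "x $ l * det (\<chi> j. if j = m then ?N $ l else ?N $ j) = (if l = m then x $ m * det M else 0)"
    proof (cases "l = m")
      case True
      then have "(\<chi> j. if j = m then ?N $ l else ?N $ j) = ?N" by (simp add: vec_eq_iff)
      then show ?thesis using True by simp
    next
      case False
      then have "det (\<chi> j. if j = m then ?N $ l else ?N $ j) = 0"
        by (intro det_identical_rows[of l m]) (auto simp: row_def)
      then show ?thesis using False by simp
    qed
  qed
  finally show ?thesis by simp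
qed

text \<open>Expanding the replaced row in unit vectors leaves the cofactors \<open>D k\<close>; thus
  \<open>x $ m * det M\<close> lies in the ideal of the entries of \<open>M *v x\<close>.\<close>

lemma det_mult_vec_expand:
  fixes M :: "'a::comm_ring_1^'n^'n"
  shows "\<exists>D. x $ m * det M = (\<Sum>k\<in>UNIV. (M *v x) $ k * D k)"
proof -
  let ?N = "transpose M"
  define y where "y = M *v x"
  have y: "y = (\<Sum>k\<in>UNIV. y $ k *s axis k 1)"
    by (simp add: vec_eq_iff axis_def if_distrib[of "(*) _"] cong: if_cong)
  have "det (\<chi> j. if j = m then y else ?N $ j)
      = det (\<chi> j. if j = m then (\<Sum>k\<in>UNIV. y $ k *s axis k 1) else ?N $ j)"
    by (rule arg_cong[OF y, of "\<lambda>v. det (\<chi> j. if j = m then v else ?N $ j)"])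
  also have "\<dots> = (\<Sum>k\<in>UNIV. det (\<chi> j. if j = m then y $ k *s axis k 1 else ?N $ j))"
    using det_linear_row_sum[of "UNIV :: 'n set" m "\<lambda>_ k. y $ k *s axis k 1" "\<lambda>j. ?N $ j"]
    by (simp cong: if_cong)
  also have "\<dots> = (\<Sum>k\<in>UNIV. y $ k * det (\<chi> j. if j = m then axis k 1 else ?N $ j))"
    by (intro sum.cong refl det_row_mul)
  finally have "x $ m * det M = (\<Sum>k\<in>UNIV. y $ k * det (\<chi> j. if j = m then axis k 1 else ?N $ j))"
    by (simp only: det_mult_vec[of x m M] y_def)
  then show ?thesis
    unfolding y_def by (rule exI[of _ "\<lambda>k. det (\<chi> j. if j = m then axis k 1 else ?N $ j)"])
qed

text \<open>
  Rows may be exchanged one at a time.  The difference of the two determinants is the determinant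
  of a matrix \<open>N\<close> with \<open>(N g)\<^sub>i = 0\<close>, so Cramer's rule puts \<open>g\<^sub>m det N\<close> into the ideal of the
  remaining powers; \<open>x\<^sub>i\<^sup>\<mu>\<^sup>i\<^sup>+\<^sup>1\<close> is a combination of the \<open>g\<^sub>m\<close> and a nonzerodivisor modulo that ideal.
\<close>

lemma coeff_det_row_change:
  fixes M N :: "'n::finite cps^'n^'n"
  assumes M: "M *v g = (\<chi> i. coord i ^ Suc (\<mu> $ i))" and M': "M' *v g = (\<chi> i. coord i ^ Suc (\<mu> $ i))"
    and off: "\<And>k. k \<noteq> i \<Longrightarrow> M' $ k = M $ k"
  shows "coeff (det M * h) \<mu> = coeff (det M' * h) \<mu>"
proof -
  define N where "N = (\<chi> k. if k = i then M $ i - M' $ i else M $ k)"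
  have row: "(A *v g) $ k = (\<Sum>j\<in>UNIV. A $ k $ j * g $ j)" for A :: "'n cps^'n^'n" and k
    by (simp add: matrix_vector_mult_def)
  have Ng: "(N *v g) $ k = (if k = i then 0 else coord k ^ Suc (\<mu> $ k))" for k
    using arg_cong[OF M, of "\<lambda>v. v $ k"] arg_cong[OF M', of "\<lambda>v. v $ k"]
    unfolding row by (auto simp: N_def left_diff_distrib sum_subtractf)
  have "det M = det N + det M'"
  proof -
    have "M = (\<chi> k. if k = i then (M $ i - M' $ i) + M' $ i else M $ k)"
      by (simp add: vec_eq_iff)
    moreover have "M' = (\<chi> k. if k = i then M' $ i else M $ k)"
      using off by (simp add: vec_eq_iff)
    ultimately show ?thesis
      using det_row_add[of i "\<lambda>_. M $ i - M' $ i" "\<lambda>_. M' $ i" "\<lambda>k. M $ k"]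
      unfolding N_def by metis
  qed
  moreover have "coeff (det N * h) \<mu> = 0"
  proof (rule ccontr)
    assume "coeff (det N * h) \<mu> \<noteq> 0"
    then obtain \<beta> \<gamma> where \<beta>: "\<mu> = \<beta> + \<gamma>" "coeff (det N) \<beta> \<noteq> 0" by (rule coeff_mult_nz)
    have "\<exists>D. \<forall>m. g $ m * det N = (\<Sum>k\<in>UNIV. (N *v g) $ k * D m k)"
      using det_mult_vec_expand[of g _ N] by metis
    then obtain D where D: "\<And>m. g $ m * det N = (\<Sum>k\<in>UNIV. (N *v g) $ k * D m k)" by blast
    have "coord i ^ Suc (\<mu> $ i) = (\<Sum>m\<in>UNIV. M $ i $ m * g $ m)"
      using arg_cong[OF M, of "\<lambda>v. v $ i"] unfolding row by simp
    then have "coord i ^ Suc (\<mu> $ i) * det N = (\<Sum>m\<in>UNIV. M $ i $ m * (g $ m * det N))"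
      by (simp only: sum_distrib_right mult.assoc)
    also have "\<dots> = (\<Sum>k\<in>UNIV. (N *v g) $ k * (\<Sum>m\<in>UNIV. M $ i $ m * D m k))"
      unfolding D sum_distrib_left by (subst sum.swap) (simp add: mult_ac)
    finally have *: "mon (axis i (Suc (\<mu> $ i))) * det N
        = (\<Sum>k\<in>UNIV. (N *v g) $ k * (\<Sum>m\<in>UNIV. M $ i $ m * D m k))"
      unfolding coord_power_eq_mon .
    \<comment> \<open>The shift changes only the \<open>i\<close>-th exponent. The others are at
      most those of \<mu>, so no power \<open>coord k ^ Suc (\<mu> $ k)\<close> with
      \<open>k \<noteq> i\<close> divides a monomial with this exponent.\<close>
    have "coeff (det N) \<beta> = coeff (mon (axis i (Suc (\<mu> $ i))) * det N) (axis i (Suc (\<mu> $ i)) + \<beta>)"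
      by (rule coeff_mon_mult_shift[symmetric])
    also have "\<dots> = 0"
      unfolding * coeff_sum
    proof (intro sum.neutral ballI)
      fix k
      have "k \<noteq> i \<Longrightarrow> (axis i (Suc (\<mu> $ i)) + \<beta>) $ k < Suc (\<mu> $ k)"
        using \<beta>(1) by (simp add: axis_def)
      then show "coeff ((N *v g) $ k * (\<Sum>m\<in>UNIV. M $ i $ m * D m k)) (axis i (Suc (\<mu> $ i)) + \<beta>) = 0"
        using coeff_coord_power_mult_eq_0[of "axis i (Suc (\<mu> $ i)) + \<beta>" k "Suc (\<mu> $ k)"]
        unfolding Ng by (cases "k = i") auto
    qed
    finally show False using \<beta>(2) by simp
  qed
  ultimately show ?thesis by (simp add: distrib_right)
qed

lemma coeff_det_unique:
  fixes M M' :: "'n::finite cps^'n^'n"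
  assumes M: "M *v g = (\<chi> i. coord i ^ Suc (\<mu> $ i))" and M': "M' *v g = (\<chi> i. coord i ^ Suc (\<mu> $ i))"
  shows "coeff (det M * h) \<mu> = coeff (det M' * h) \<mu>"
proof -
  \<comment> \<open>\<open>N S\<close> takes the rows in \<open>S\<close> from \<open>M'\<close>;
    every such mixture still sends \<open>g\<close> to the same powers.\<close>
  define N where "N S = (\<chi> k. if k \<in> S then M' $ k else M $ k)" for S
  have Ng: "N S *v g = (\<chi> i. coord i ^ Suc (\<mu> $ i))" for S
  proof -
    have "(N S *v g) $ k = (if k \<in> S then (M' *v g) $ k else (M *v g) $ k)" for k
      by (simp add: N_def matrix_vector_mult_def)
    then show ?thesis by (simp add: M M' vec_eq_iff)
  qed
  have "coeff (det (N S) * h) \<mu> = coeff (det M * h) \<mu>" if "finite S" for S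
    using that
  proof induction
    case empty
    have "N {} = M" by (simp add: N_def)
    then show ?case by simp
  next
    case (insert i S)
    have "coeff (det (N (insert i S)) * h) \<mu> = coeff (det (N S) * h) \<mu>"
      by (rule coeff_det_row_change[where i = i, OF Ng Ng]) (simp add: N_def)
    then show ?case using insert.IH by simp
  qed
  moreover have "N UNIV = M'" by (simp add: N_def)
  ultimately show ?thesis by (metis finite_class.finite_UNIV)
qed

lemma prod_coord_powers: "(\<Prod>i\<in>UNIV. coord i ^ (\<delta> $ i)) = mon \<delta>"
proof -
  have "(\<Prod>i\<in>S. coord i ^ (\<delta> $ i)) = mon (\<Sum>i\<in>S. axis i (\<delta> $ i))" if "finite S" for S
    using that by induction (simp_all add: mon_0 mon_add coord_power_eq_mon)
  moreover have "(\<Sum>i\<in>UNIV. axis i (\<delta> $ i)) = \<delta>"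
    by (simp add: vec_eq_iff axis_def)
  ultimately show ?thesis by (metis finite_class.finite_UNIV)
qed

text \<open>This is the transition map between two systems of powers: multiplying row
  \<open>i\<close> by \<open>coord i ^ (\<delta> $ i)\<close> multiplies the determinant by
  \<open>mon \<delta>\<close>, which shifts the coefficient that is read off.\<close>

lemma residue_via_shift:
  assumes "residue_via h g \<nu> B c"
  shows "\<exists>B'. residue_via h g (\<delta> + \<nu>) B' c"
proof -
  have B: "(\<Sum>j\<in>UNIV. B $ i $ j * g $ j) = coord i ^ Suc (\<nu> $ i)" for i
    using assms unfolding residue_via_def by (auto simp: vec_eq_iff matrix_vector_mult_def)
  define B' where "B' = (\<chi> i. coord i ^ (\<delta> $ i) *s B $ i)"
  have "B' *v g = (\<chi> i. coord i ^ Suc ((\<delta> + \<nu>) $ i))"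
  proof (subst vec_eq_iff, intro allI)
    fix i
    have "(B' *v g) $ i = coord i ^ (\<delta> $ i) * (\<Sum>j\<in>UNIV. B $ i $ j * g $ j)"
      by (simp add: B'_def matrix_vector_mult_def sum_distrib_left mult.assoc)
    then show "(B' *v g) $ i = (\<chi> i. coord i ^ Suc ((\<delta> + \<nu>) $ i)) $ i"
      unfolding B by (simp add: power_add mult_ac)
  qed
  moreover have "det B' = mon \<delta> * det B"
    unfolding B'_def det_rows_mul by (simp add: prod_coord_powers)
  ultimately have "residue_via h g (\<delta> + \<nu>) B' c"
    using assms coeff_mon_mult_shift[of \<delta> "det B * h" \<nu>]
    by (simp add: residue_via_def mult.assoc)
  then show ?thesis ..
qed

text \<open>The definite description is justified by moving any two presentations to the common
  exponent \<open>\<nu> + \<nu>'\<close>, where \<open>coeff_det_unique\<close> compares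
  them.\<close>

lemma Res0_eqI:
  assumes "residue_via h g \<nu> B c"
  shows "Res0 h g = c"
  unfolding Res0_def
proof (rule the_equality)
  show "\<exists>\<nu> B. residue_via h g \<nu> B c" using assms by blast
  fix c' assume "\<exists>\<nu> B. residue_via h g \<nu> B c'"
  then obtain \<nu>' B' where "residue_via h g \<nu>' B' c'" by blast
  then obtain C' where C': "residue_via h g (\<nu> + \<nu>') C' c'" using residue_via_shift by blast
  obtain C where C: "residue_via h g (\<nu>' + \<nu>) C c" using assms residue_via_shift by blast
  show "c' = c"
    using C C' coeff_det_unique[of C g "\<nu> + \<nu>'" C' h]
    by (simp add: residue_via_def add.commute[of \<nu>'])
qed

section \<open>Rescaling\<close>

text \<open>\<open>t\<^sup>-\<^sup>k f(tz,w)\<close> for \<open>f \<in> zfil K k\<close>, where \<open>k\<close> may be negative.\<close>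

lift_definition wscale :: "'n set \<Rightarrow> int \<Rightarrow> complex \<Rightarrow> 'n::finite cps \<Rightarrow> 'n cps" is
  "\<lambda>K k t a \<alpha>. t ^ nat (int (mdeg K \<alpha>) - k) * a \<alpha>"
proof -
  fix K k and t :: complex and a :: "nat^'n \<Rightarrow> complex"
  assume a: "converges_near_0 a"
  \<comment> \<open>Convergence reduces to that of \<open>rescale\<close> at \<open>nat k\<close>; a
    negative \<open>k\<close> only adds the constant factor \<open>t ^ nat (- k)\<close>.\<close>
  define b where "b = coeff (rescale K (nat k) t (Abs_cps a))"
  have b: "b \<alpha> = t ^ (mdeg K \<alpha> - nat k) * a \<alpha>" for \<alpha>
    using a by (simp add: b_def rescale.rep_eq Abs_cps_inverse)
  obtain r where r: "r > 0" "(\<lambda>\<alpha>. norm (b \<alpha>) * r ^ mdeg UNIV \<alpha>) summable_on UNIV"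
    using coeff[of "rescale K (nat k) t (Abs_cps a)"] unfolding converges_near_0_def b_def by blast
  have "t ^ nat (int (mdeg K \<alpha>) - k) * a \<alpha> = t ^ nat (- k) * b \<alpha>" for \<alpha>
  proof -
    have "nat (int (mdeg K \<alpha>) - k) = nat (- k) + (mdeg K \<alpha> - nat k)" by linarith
    then show ?thesis by (simp add: b power_add mult.assoc)
  qed
  moreover have "(\<lambda>\<alpha>. norm (t ^ nat (- k) * b \<alpha>) * r ^ mdeg UNIV \<alpha>) summable_on UNIV"
    by (rule weighted_summable_mono[OF r(2), where C = "norm (t ^ nat (- k))"])
      (use r(1) in \<open>simp_all add: norm_mult\<close>)
  ultimately show "converges_near_0 (\<lambda>\<alpha>. t ^ nat (int (mdeg K \<alpha>) - k) * a \<alpha>)"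
    unfolding converges_near_0_def using r(1) by auto
qed

lemma rescale_eq_wscale: "rescale K d t f = wscale K (int d) t f"
proof (rule cps_eqI)
  fix \<alpha>
  have "nat (int (mdeg K \<alpha>) - int d) = mdeg K \<alpha> - d" by linarith
  then show "coeff (rescale K d t f) \<alpha> = coeff (wscale K (int d) t f) \<alpha>"
    by (simp add: rescale.rep_eq wscale.rep_eq)
qed

text \<open>The order bounds make both exponents genuine differences wherever the coefficients are
  nonzero, so truncation by \<open>nat\<close> does not spoil additivity.\<close>

lemma wscale_mult:
  assumes f: "f \<in> zfil K k" and g: "g \<in> zfil K l"
  shows "wscale K (k + l) t (f * g) = wscale K k t f * wscale K l t g"
proof (rule cps_eqI)
  fix \<alpha>
  have *: "t ^ nat (int (mdeg K (\<beta> + \<gamma>)) - (k + l)) * (coeff f \<beta> * coeff g \<gamma>) =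
      coeff (wscale K k t f) \<beta> * coeff (wscale K l t g) \<gamma>" for \<beta> \<gamma>
  proof (cases "coeff f \<beta> = 0 \<or> coeff g \<gamma> = 0")
    case False
    then have "nat (int (mdeg K (\<beta> + \<gamma>)) - (k + l)) = nat (int (mdeg K \<beta>) - k) + nat (int (mdeg K \<gamma>) - l)"
      using zfilD[OF f, of \<beta>] zfilD[OF g, of \<gamma>] by (simp add: mdeg_add)
    then show ?thesis by (simp add: wscale.rep_eq power_add mult_ac)
  qed (auto simp: wscale.rep_eq)
  have "coeff (wscale K (k + l) t (f * g)) \<alpha> = (\<Sum>p | fst p + snd p = \<alpha>.
      t ^ nat (int (mdeg K (fst p + snd p)) - (k + l)) * (coeff f (fst p) * coeff g (snd p)))"
    by (simp add: wscale.rep_eq times_cps.rep_eq sum_distrib_left)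
  also have "\<dots> = coeff (wscale K k t f * wscale K l t g) \<alpha>"
    unfolding times_cps.rep_eq * ..
  finally show "coeff (wscale K (k + l) t (f * g)) \<alpha> = coeff (wscale K k t f * wscale K l t g) \<alpha>" .
qed

lemma wscale_sum: "wscale K k t (\<Sum>i\<in>A. f i) = (\<Sum>i\<in>A. wscale K k t (f i))"
  by (rule cps_eqI) (simp add: wscale.rep_eq sum_distrib_left)

lemma wscale_1: "wscale K 0 t 1 = 1"
  by (rule cps_eqI) (simp add: wscale.rep_eq one_cps.rep_eq)

lemma wscale_prod:
  assumes "\<And>i. i \<in> A \<Longrightarrow> f i \<in> zfil K (k i)"
  shows "wscale K (\<Sum>i\<in>A. k i) t (\<Prod>i\<in>A. f i) = (\<Prod>i\<in>A. wscale K (k i) t (f i))"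
  using assms
proof (induction A rule: infinite_finite_induct)
  case (insert i A)
  then have "wscale K (k i + sum k A) t (f i * prod f A) = wscale K (k i) t (f i) * wscale K (sum k A) t (prod f A)"
    by (intro wscale_mult zfil_prod) auto
  then show ?case using insert by simp
qed (simp_all add: wscale_1)

lemma wscale_sign: "wscale K k t (of_int (sign p) * f) = of_int (sign p) * wscale K k t f"
  by (rule cps_eqI) (simp add: sign_def wscale.rep_eq)

text \<open>This gives all terms of the Leibniz formula the same weight when entry
  \<open>(i, j)\<close> has weight \<open>a i - b j\<close>.\<close>

lemma sum_diff_permute:
  fixes a b :: "'n::finite \<Rightarrow> int"
  assumes "p permutes UNIV"
  shows "(\<Sum>i\<in>UNIV. a i - b (p i)) = (\<Sum>i\<in>UNIV. a i) - (\<Sum>i\<in>UNIV. b i)"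
  using sum.permute[OF assms, of b] by (simp add: sum_subtractf o_def)

lemma det_in_zfil:
  fixes M :: "'n::finite cps^'n^'n"
  assumes "\<And>i j. M $ i $ j \<in> zfil K (a i - b j)"
  shows "det M \<in> zfil K ((\<Sum>i\<in>UNIV. a i) - (\<Sum>i\<in>UNIV. b i))"
  unfolding det_def
proof (intro zfil_sum zfil_mult_right)
  fix p assume p: "p \<in> {p. p permutes (UNIV :: 'n set)}"
  show "(\<Prod>i\<in>UNIV. M $ i $ p i) \<in> zfil K ((\<Sum>i\<in>UNIV. a i) - (\<Sum>i\<in>UNIV. b i))"
    using zfil_prod[of UNIV "\<lambda>i. M $ i $ p i" K "\<lambda>i. a i - b (p i)"] assms p
    by (simp add: sum_diff_permute)
qed

lemma wscale_det:
  fixes M :: "'n::finite cps^'n^'n"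
  assumes "\<And>i j. M $ i $ j \<in> zfil K (a i - b j)"
  shows "wscale K ((\<Sum>i\<in>UNIV. a i) - (\<Sum>i\<in>UNIV. b i)) t (det M)
      = det (\<chi> i j. wscale K (a i - b j) t (M $ i $ j))"
  unfolding det_def wscale_sum wscale_sign
proof (intro sum.cong refl)
  fix p assume p: "p \<in> {p. p permutes (UNIV :: 'n set)}"
  have "wscale K ((\<Sum>i\<in>UNIV. a i) - (\<Sum>i\<in>UNIV. b i)) t (\<Prod>i\<in>UNIV. M $ i $ p i)
      = (\<Prod>i\<in>UNIV. wscale K (a i - b (p i)) t (M $ i $ p i))"
    using wscale_prod[of UNIV "\<lambda>i. M $ i $ p i" K "\<lambda>i. a i - b (p i)" t] assms p
    by (simp add: sum_diff_permute)
  then show "of_int (sign p) * wscale K ((\<Sum>i\<in>UNIV. a i) - (\<Sum>i\<in>UNIV. b i)) t (\<Prod>i\<in>UNIV. M $ i $ p i)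
      = of_int (sign p) * (\<Prod>i\<in>UNIV. (\<chi> i j. wscale K (a i - b j) t (M $ i $ j)) $ i $ p i)"
    by simp
qed

lemma wscale_coord_power: "wscale K (int (if i \<in> K then n else 0)) t (coord i ^ n) = coord i ^ n"
  by (rule cps_eqI) (auto simp: wscale.rep_eq coord_power_eq_mon mon.rep_eq)

text \<open>The row identities are homogeneous of weight equal to the z-degree of the power on the
  right, so they survive rescaling and leave that power fixed, for \<open>t = 0\<close> as
  well.\<close>

lemma residue_via_rescaled:
  fixes q :: "'n::finite cps^'n"
  assumes q: "\<And>j. q $ j \<in> zfil K (int (d j))"
    and B: "B *v q = (\<chi> i. coord i ^ Suc (\<nu> $ i))"
    and Bz: "\<And>i j. B $ i $ j \<in> zfil K (int (if i \<in> K then Suc (\<nu> $ i) else 0) - int (d j))"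
  shows "residue_via (wscale K 0 t u) (\<chi> j. rescale K (d j) t (q $ j)) \<nu>
      (\<chi> i j. wscale K (int (if i \<in> K then Suc (\<nu> $ i) else 0) - int (d j)) t (B $ i $ j))
      (t ^ ((\<Sum>j\<in>UNIV. d j) - card K) * coeff (det B * u) \<nu>)"
proof -
  define e where "e i = int (if i \<in> K then Suc (\<nu> $ i) else 0)" for i
  define m where "m = (\<Sum>i\<in>UNIV. e i) - (\<Sum>j\<in>UNIV. int (d j))"
  have Bz': "B $ i $ j \<in> zfil K (e i - int (d j))" for i j using Bz by (simp add: e_def)
  have row: "(\<Sum>j\<in>UNIV. wscale K (e i - int (d j)) t (B $ i $ j) * wscale K (int (d j)) t (q $ j))
      = coord i ^ Suc (\<nu> $ i)" for i
  proof -
    have "wscale K (e i - int (d j)) t (B $ i $ j) * wscale K (int (d j)) t (q $ j)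
        = wscale K (e i) t (B $ i $ j * q $ j)" for j
      using wscale_mult[OF Bz'[of i j] q[of j], of t] by simp
    moreover have "(\<Sum>j\<in>UNIV. B $ i $ j * q $ j) = coord i ^ Suc (\<nu> $ i)"
      using arg_cong[OF B, of "\<lambda>v. v $ i"] by (simp add: matrix_vector_mult_def)
    ultimately show ?thesis
      using wscale_coord_power[of K i "Suc (\<nu> $ i)" t] by (simp add: e_def flip: wscale_sum)
  qed
  have "(\<Sum>i\<in>UNIV. e i) = int (mdeg K \<nu>) + int (card K)"
  proof -
    have "(\<Sum>i\<in>UNIV. e i) = (\<Sum>i\<in>UNIV. if i \<in> K then int (Suc (\<nu> $ i)) else 0)"
      unfolding e_def by (rule sum.cong) auto
    then show ?thesis by (simp add: mdeg_def sum.If_cases sum.distrib)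
  qed
  \<comment> \<open>The z-degree of \<nu> falls short of the sum of the \<open>e i\<close> by
    \<open>card K\<close>, because of the \<open>Suc\<close> in each exponent; \<open>nat\<close>
    and subtraction of naturals truncate alike.\<close>
  then have exponent: "nat (int (mdeg K \<nu>) - m) = (\<Sum>j\<in>UNIV. d j) - card K"
    unfolding m_def by (simp flip: of_nat_sum)
  have "det (\<chi> i j. wscale K (e i - int (d j)) t (B $ i $ j)) * wscale K 0 t u
      = wscale K m t (det B * u)"
    using wscale_mult[OF det_in_zfil[OF Bz'] zfil_nonpos, of 0 t u] wscale_det[OF Bz', of t]
    by (simp add: m_def)
  then have "coeff (det (\<chi> i j. wscale K (e i - int (d j)) t (B $ i $ j)) * wscale K 0 t u) \<nu>
      = t ^ ((\<Sum>j\<in>UNIV. d j) - card K) * coeff (det B * u) \<nu>"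
    by (simp add: wscale.rep_eq exponent)
  then show ?thesis
    unfolding residue_via_def rescale_eq_wscale e_def[symmetric]
    by (simp add: vec_eq_iff matrix_vector_mult_def row)
qed

section \<open>Specialisation at \<open>t = 0\<close>, derivatives, and the theorem\<close>

lemma rescale_0_eq_inD: "rescale K (ordD K f) 0 f = inD K f"
proof (rule cps_eqI)
  fix \<alpha>
  \<comment> \<open>Below the order, where the exponent is truncated to 0, the coefficients vanish;
    at the order \<open>0 ^ 0 = 1\<close> keeps the term, and above it the power of 0 removes
    it.\<close>
  show "coeff (rescale K (ordD K f) 0 f) \<alpha> = coeff (inD K f) \<alpha>"
    using zfilD[OF in_zfil_ordD, of f \<alpha> K]
    by (cases "coeff f \<alpha> = 0") (auto simp: rescale.rep_eq inD_eq_hpart hpart.rep_eq power_0_left)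
qed

lemma higher_deriv_monomial:
  fixes c :: complex
  shows "k \<le> n \<Longrightarrow> (deriv ^^ k) (\<lambda>t. t ^ n * c) = (\<lambda>t. (\<Prod>i<k. of_nat (n - i)) * t ^ (n - k) * c)"
proof (induction k)
  case (Suc k)
  have *: "deriv (\<lambda>t. (\<Prod>i<k. of_nat (n - i)) * t ^ (n - k) * c) t
      = (\<Prod>i<Suc k. of_nat (n - i)) * t ^ (n - Suc k) * c" for t :: complex
    by (rule DERIV_imp_deriv) (auto intro!: derivative_eq_intros)
  have "(deriv ^^ Suc k) (\<lambda>t. t ^ n * c) = deriv (\<lambda>t. (\<Prod>i<k. of_nat (n - i)) * t ^ (n - k) * c)"
    using Suc by simp
  then show ?case unfolding fun_eq_iff * by blast
qed simp

theorem theorem7p4: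
  fixes K :: "'n::{finite,linorder} set"
    and f g q :: "('n cps, 'n) vec"
    and A :: "(('n cps, 'n) vec, 'n) vec"
    and h \<Delta> :: "'n cps"
    and \<R> :: "complex \<Rightarrow> complex"
  assumes "K \<noteq> {}"
    and "strict_log_germ K f"
    and "isolated_fixed_point f"
    and "g = fixed_point_eqs f"
    and "normally_admissible K (ideal_gen (entries g)) q"
    and "invertible A" and "q = A *v g" and "\<Delta> = det A"
    and "\<R> = rescaled_residue K q (\<lambda>t. dilate K t h * dilate K t \<Delta>)"
  shows "(\<forall>\<^sub>F t in at 0. \<R> t = t ^ excess K q * Res0 h g) \<and>
    \<R> analytic_on {0} \<and>
    Res0 h g = 1 / fact (excess K q) * (deriv ^^ excess K q) \<R> 0 \<and>
    (excess K q = 0 \<longrightarrow>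
      Res0 h g = Res0 (dilate K 0 h * dilate K 0 \<Delta>) (\<chi> j. inD K (q $ j)))"
proof -
  define d where "d j = ordD K (q $ j)" for j
  have q: "q $ j \<in> zfil K (int (d j))" for j by (simp add: d_def in_zfil_ordD)
  have fl: "finite_length_quotient (ideal_gen (entries (\<chi> j. hpart K (d j) (q $ j))))"
    using assms(5) unfolding normally_admissible_def inD_eq_hpart d_def by (elim conjE)
  obtain B \<nu> where B: "B *v q = (\<chi> i. coord i ^ Suc (\<nu> $ i))"
    and Bz: "\<forall>i j. B $ i $ j \<in> zfil K (int (if i \<in> K then Suc (\<nu> $ i) else 0) - int (d j))"
    by (rule graded_presentation_of_powers[OF q fl])
  define c where "c = coeff (det B * (h * \<Delta>)) \<nu>"
  \<comment> \<open>The identity holds for every \<open>t\<close>, including 0, so \<R> is a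
    constant times a power of \<open>t\<close>; analyticity, the derivative and the value at 0 are
    read off from it.\<close>
  have \<R>: "\<R> t = t ^ excess K q * c" for t
  proof -
    have "dilate K t h * dilate K t \<Delta> = wscale K 0 t (h * \<Delta>)"
      using wscale_mult[of h K 0 \<Delta> 0 t] by (simp add: rescale_eq_wscale zfil_nonpos)
    then show ?thesis
      using Res0_eqI[OF residue_via_rescaled[OF q B Bz[rule_format], of t "h * \<Delta>"]]
      unfolding assms(9) rescaled_residue_def excess_def d_def c_def by (simp only:)
  qed
  \<comment> \<open>Relative to \<open>g\<close> the matrix is \<open>B ** A\<close>, whose
    determinant supplies the factor \<Delta>; so the same number \<open>c\<close> is the residue for
    \<open>g\<close>.\<close>
  have "(B ** A) *v g = B *v q" using assms(7) by (simp add: matrix_vector_mul_assoc)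
  then have "residue_via h g \<nu> (B ** A) c"
    using B by (simp add: residue_via_def c_def det_mul assms(8) mult_ac)
  then have c: "Res0 h g = c" by (rule Res0_eqI)
  have "\<R> analytic_on {0}"
    unfolding \<R>[abs_def] by (intro analytic_intros)
  moreover have "(deriv ^^ excess K q) \<R> 0 = fact (excess K q) * c"
    unfolding \<R>[abs_def] by (simp add: higher_deriv_monomial fact_prod_rev lessThan_atLeast0)
  \<comment> \<open>At \<open>t = 0\<close> the rescaled generators are the initial forms; for
    \<open>excess K q = 0\<close> the value there is \<open>c\<close>.\<close>
  moreover have "Res0 (dilate K 0 h * dilate K 0 \<Delta>) (\<chi> j. inD K (q $ j)) = \<R> 0"
    by (simp add: assms(9) rescaled_residue_def rescale_0_eq_inD)
  ultimately show ?thesis by (simp add: c \<R>)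
qed

end
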